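(* Let $d\ge1$, $Q_d=[0,1]^d$, and for $\mathbf k\in\mathbb{N}_0^d$ let $\ell(\mathbf k)$ be the number of nonzero components of $\mathbf k$. Let $$N_d=\sup_{r>0}\ r^{-d}\sum_{\substack{\mathbf k\in\mathbb{N}_0^d\\ 0<|\mathbf k|<r}}2^{\ell(\mathbf k)}.$$ Then $$N_d\le\sum_{\ell=1}^d\binom{d}{\ell}\frac{\omega_\ell}{\ell^{(d-\ell)/2}},$$ and $$G_Q(d)\ \ge\ \frac{\pi^2 d^2}{(d+4)(d+2)N_d^{2/d}}.$$
   Context: $\omega_\ell$ is the volume of the unit ball in $\mathbb{R}^\ell$; $\mathbb{N}_0=\{0,1,2,\dots\}$. For a bounded domain $\Omega\subset\mathbb{R}^d$, $$G(\Omega,d)=\inf\frac{\int_\Omega|\nabla u|^2\,\mathrm{d}x\left(\int_\Omega u^2\,\mathrm{d}x\right)^{2/d}}{\int_\Omega|u-u_\Omega|^{2+4/d}\,\mathrm{d}x},$$ the infimum over (non-constant) $u\in W^{1,1}(\Omega)$, where $u_\Omega=|\Omega|^{-1}\int_\Omega u$. Write $G_Q(d)=G([0,1]^d,d)$. *)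

theory Defs
  imports "HOL-Analysis.Analysis"
begin

definition partial :: "'n::finite \<Rightarrow> (real^'n \<Rightarrow> real) \<Rightarrow> real^'n \<Rightarrow> real" where
  "partial i f x = frechet_derivative f (at x) (axis i 1)"

fun iter_partial :: "'n::finite list \<Rightarrow> (real^'n \<Rightarrow> real) \<Rightarrow> real^'n \<Rightarrow> real" where
  "iter_partial [] f = f"
| "iter_partial (i # is) f = partial i (iter_partial is f)"

definition smooth :: "(real^'n::finite \<Rightarrow> real) \<Rightarrow> bool" where
  "smooth f \<longleftrightarrow> (\<forall>is x. iter_partial is f differentiable (at x))"

definition test_fun :: "(real^'n::finite) set \<Rightarrow> (real^'n \<Rightarrow> real) \<Rightarrow> bool" where
  "test_fun \<Omega> \<phi> \<longleftrightarrow> smooth \<phi> \<and> compact (closure {x. \<phi> x \<noteq> 0}) \<and> closure {x. \<phi> x \<noteq> 0} \<subseteq> \<Omega>"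

definition W11_grad :: "(real^'n::finite) set \<Rightarrow> (real^'n \<Rightarrow> real) \<Rightarrow> (real^'n \<Rightarrow> real^'n) \<Rightarrow> bool" where
  "W11_grad \<Omega> u g \<longleftrightarrow>
     set_integrable lborel \<Omega> u \<and>
     (\<forall>i. set_integrable lborel \<Omega> (\<lambda>x. g x $ i)) \<and>
     (\<forall>i \<phi>. test_fun \<Omega> \<phi> \<longrightarrow>
        (\<integral>x\<in>\<Omega>. u x * partial i \<phi> x \<partial>lborel) = - (\<integral>x\<in>\<Omega>. g x $ i * \<phi> x \<partial>lborel))"

definition mean_on :: "(real^'n::finite) set \<Rightarrow> (real^'n \<Rightarrow> real) \<Rightarrow> real" where
  "mean_on \<Omega> u = (\<integral>x\<in>\<Omega>. u x \<partial>lborel) / measure lborel \<Omega>"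

text \<open>G(Omega,d). Functions with infinite numerator contribute +infinity and are omitted;
  the quotient is taken in ennreal so an infinite denominator gives 0.\<close>
definition G :: "(real^'n::finite) set \<Rightarrow> nat \<Rightarrow> ennreal" where
  "G \<Omega> d = Inf { ennreal (enn2real (\<integral>\<^sup>+x\<in>\<Omega>. ennreal ((norm (g x))\<^sup>2) \<partial>lborel)
                     * enn2real (\<integral>\<^sup>+x\<in>\<Omega>. ennreal ((u x)\<^sup>2) \<partial>lborel) powr (2 / real d))
                  / (\<integral>\<^sup>+x\<in>\<Omega>. ennreal (\<bar>u x - mean_on \<Omega> u\<bar> powr (2 + 4 / real d)) \<partial>lborel)
       | u g. W11_grad \<Omega> u g
              \<and> \<not> (\<exists>c. AE x in lborel. x \<in> \<Omega> \<longrightarrow> u x = c)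
              \<and> (\<integral>\<^sup>+x\<in>\<Omega>. ennreal ((norm (g x))\<^sup>2) \<partial>lborel) < \<infinity>
              \<and> (\<integral>\<^sup>+x\<in>\<Omega>. ennreal ((u x)\<^sup>2) \<partial>lborel) < \<infinity> }"

text \<open>G_Q(d) for d = CARD('n): open unit cube (null boundary, same integrals as [0,1]^d).\<close>
definition GQ :: "'n::finite itself \<Rightarrow> ennreal" where
  "GQ _ = G (box 0 (1::real^'n)) CARD('n)"

definition knorm :: "('n::finite \<Rightarrow> nat) \<Rightarrow> real" where
  "knorm k = sqrt (\<Sum>i\<in>UNIV. (real (k i))\<^sup>2)"

definition nzcount :: "('n::finite \<Rightarrow> nat) \<Rightarrow> nat" where
  "nzcount k = card {i. k i \<noteq> 0}"

definition Nd :: "'n::finite itself \<Rightarrow> ereal" where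
  "Nd _ = (SUP r\<in>{0<..}. ereal (r powr (- real CARD('n)) *
             (\<Sum>k\<in>{k::'n \<Rightarrow> nat. 0 < knorm k \<and> knorm k < r}. 2 ^ nzcount k)))"

end

theory Submission
  imports Defs
begin

text \<open>
  The bound on \<open>N\<^sub>d\<close> compares, for each support \<open>S\<close> of the multi-index, the weighted lattice count
  with the volume of a ball in dimension \<open>card S\<close>; multi-indices with support \<open>S\<close> have norm at
  least \<open>sqrt (card S)\<close>.

  The lower bound on \<open>G\<^sub>Q\<close> follows Rumin's method. Let \<open>w\<^sub>E\<close> be the part of \<open>u\<close> on the Neumann
  eigenvalues \<open>\<pi>\<^sup>2|k|\<^sup>2 \<ge> E\<close> of the cube. By Parseval and the layer-cake formula,
  the integral over \<open>E > 0\<close> of \<open>\<parallel>w\<^sub>E\<parallel>\<^sup>2\<close> is the sum of \<open>\<pi>\<^sup>2|k|\<^sup>2 a\<^sub>k\<^sup>2\<close>, which Bessel's inequality for the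
  weak gradient (expanded in products with one sine factor) bounds by the Dirichlet integral. The remaining
  non-constant part is at most \<open>A E\<^bsup>d/4\<^esup>\<close> pointwise, with \<open>A\<^sup>2 = N\<^sub>d \<parallel>u\<parallel>\<^sup>2 / \<pi>\<^sup>d\<close>, because the
  eigenfunctions are bounded by \<open>2\<^bsup>\<ell>(k)/2\<^esup>\<close>. Integrating the square of the positive part of
  \<open>|u - mean| - A E\<^bsup>d/4\<^esup>\<close> first in \<open>E\<close> and then over the cube gives the inequality.
\<close>

section \<open>Lattice points and the constant N\<close>

text \<open>The obstacle is that \<open>W11_grad\<close> tests only against smooth functions with
  compact support in the open cube, whereas the trigonometric products that yield the coefficients
  of the gradient reach the boundary. They have to be cut off, and a cutoff of width e has a
  derivative of size 1/e. A test for the component \<open>i\<close> differentiates only in direction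
  \<open>i\<close>, and there the product has its sine factor, which vanishes linearly at both faces
  and absorbs the 1/e. All other directions see the cutoff itself, which is bounded by 1.
  Completeness is proved for the cosine system alone; the gradient sum is only bounded from above,
  so Bessel is enough on that side. The exponents come from scaling: the weighted number of modes
  below E grows at most like \<open>E powr (d / 2)\<close>, its square root is the factor
  \<open>E powr (d / 4)\<close>, and the square of the positive part of
  \<open>b - A * E powr (d / 4)\<close> integrates in E to a multiple of
  \<open>b powr (2 + 4 / d)\<close>, the power in the denominator of \<open>G\<close>. The mode k =
  0 is the mean, which is why \<open>Nd\<close> sums over positive norms only.\<close>

lemma knorm_nonneg [simp]: "0 \<le> knorm k"
  by (simp add: knorm_def sum_nonneg)

lemma component_le_knorm: "real (k i) \<le> knorm k"
proof -
  have "(real (k i))\<^sup>2 \<le> (\<Sum>i\<in>UNIV. (real (k i))\<^sup>2)"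
    by (rule member_le_sum) auto
  thus ?thesis unfolding knorm_def by (rule real_le_rsqrt)
qed

lemma finite_knorm_less: "finite {k :: 'n::finite \<Rightarrow> nat. knorm k < r}"
proof (rule finite_subset)
  show "{k :: 'n \<Rightarrow> nat. knorm k < r} \<subseteq> PiE UNIV (\<lambda>_. {..nat \<lceil>r\<rceil>})"
  proof
    fix k :: "'n \<Rightarrow> nat" assume "k \<in> {k. knorm k < r}"
    hence "real (k i) < r" for i using component_le_knorm[of k i] by simp
    hence "k i \<le> nat \<lceil>r\<rceil>" for i by (meson less_imp_le of_nat_le_iff order_trans real_nat_ceiling_ge)
    thus "k \<in> PiE UNIV (\<lambda>_. {..nat \<lceil>r\<rceil>})" by auto
  qed
qed (auto intro: finite_PiE)

lemma knorm_support: "(knorm k)\<^sup>2 = (\<Sum>i | k i \<noteq> 0. (real (k i))\<^sup>2)"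
  unfolding knorm_def by (subst real_sqrt_pow2) (auto intro!: sum.mono_neutral_right sum_nonneg)

lemma sqrt_support_le_knorm: "sqrt (real (nzcount k)) \<le> knorm k"
proof -
  have "real (nzcount k) = (\<Sum>i | k i \<noteq> 0. 1)" by (simp add: nzcount_def)
  also have "\<dots> \<le> (\<Sum>i | k i \<noteq> 0. (real (k i))\<^sup>2)"
    by (rule sum_mono) (simp add: Suc_leI)
  also have "\<dots> = (knorm k)\<^sup>2" by (simp add: knorm_support)
  finally show ?thesis by (simp add: real_le_lsqrt)
qed

text \<open>The shell consists of two unit intervals, one for each sign. The weight
  \<open>2 ^ nzcount k\<close> is thus the number of reflected unit cells that belong to one
  multi-index.\<close>

lemma emeasure_symmetric_shell:
  assumes "m \<noteq> (0::nat)"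
  shows "emeasure lborel {t::real. real m - 1 < \<bar>t\<bar> \<and> \<bar>t\<bar> < real m} = 2"
proof -
  have *: "{t::real. real m - 1 < \<bar>t\<bar> \<and> \<bar>t\<bar> < real m} = 
     {- real m <..< -(real m - 1)} \<union> {real m - 1<..<real m}"
    using assms by (auto simp: abs_if)
  have "emeasure lborel ({- real m <..< -(real m - 1)} \<union> {real m - 1<..<real m}) =
     emeasure lborel {- real m <..< -(real m - 1)} + emeasure lborel {real m - 1<..<real m}"
    using assms by (intro plus_emeasure[symmetric]) auto
  also have "\<dots> = 2" by simp
  finally show ?thesis by (simp only: *)
qed

text \<open>The shells \<open>{f. \<forall>i\<in>S. k i - 1 < \<bar>f i\<bar> < k i}\<close> are pairwise disjoint, have volume
  \<open>2 ^ card S\<close> and lie in the ball of radius \<open>r\<close>.\<close>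

lemma sum_support_le_ball:
  fixes S :: "'n::finite set"
  assumes "r > 0"
  shows "(\<Sum>k | {i. k i \<noteq> 0} = S \<and> knorm k < r. 2 ^ card S :: real)
            \<le> unit_ball_vol (real (card S)) * r ^ card S"
proof -
  interpret product_sigma_finite "\<lambda>_::'n. lborel :: real measure" ..
  \<comment> \<open>The dimension varies with \<open>S\<close>, so cells and ball live in the
    product measure over the index set \<open>S\<close> instead of a fixed Euclidean type.\<close>
  define P where "P = PiM S (\<lambda>_. lborel :: real measure)"
  define K where "K = {k :: 'n \<Rightarrow> nat. {i. k i \<noteq> 0} = S \<and> knorm k < r}"
  define B where "B k = PiE S (\<lambda>i. {t::real. real (k i) - 1 < \<bar>t\<bar> \<and> \<bar>t\<bar> < real (k i)})" for k :: "'n \<Rightarrow> nat"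
  have finK: "finite K"
    unfolding K_def by (rule finite_subset[OF _ finite_knorm_less[of r]]) auto
  have sets_B: "B k \<in> sets P" for k
    unfolding B_def P_def by (intro sets_PiM_I_finite) auto
  have em: "emeasure P (B k) = ennreal (2 ^ card S)" if "k \<in> K" for k
  proof -
    have "emeasure P (B k) = (\<Prod>i\<in>S. emeasure lborel {t::real. real (k i) - 1 < \<bar>t\<bar> \<and> \<bar>t\<bar> < real (k i)})"
      unfolding B_def P_def by (rule emeasure_PiM) auto
    also have "\<dots> = (\<Prod>i\<in>S. 2)"
      using that by (intro prod.cong refl emeasure_symmetric_shell) (auto simp: K_def)
    also have "\<dots> = ennreal (2 ^ card S)" by (simp flip: ennreal_power)
    finally show ?thesis .
  qed
  have disj: "disjoint_family_on B K"
    unfolding disjoint_family_on_def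
  proof safe
    fix k k' f assume k: "k \<in> K" "k' \<in> K" "k \<noteq> k'" and f: "f \<in> B k" "f \<in> B k'"
    have "k i = k' i" for i
    proof (cases "i \<in> S")
      case True
      with f have "real (k i) - 1 < \<bar>f i\<bar>" "\<bar>f i\<bar> < real (k i)" "real (k' i) - 1 < \<bar>f i\<bar>" "\<bar>f i\<bar> < real (k' i)"
        by (auto simp: B_def)
      thus ?thesis by linarith
    next
      case False
      have "i \<notin> {i. k i \<noteq> 0}" "i \<notin> {i. k' i \<noteq> 0}"
        using False k(1,2) by (simp_all only: K_def mem_Collect_eq not_False_eq_True)
      thus ?thesis by simp
    qed
    with k(3) show "f \<in> {}" by auto
  qed
  define C where "C = {f. sqrt (\<Sum>i\<in>S. (f i)\<^sup>2) \<le> r} \<inter> space P"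
  have sub: "B k \<subseteq> C" if "k \<in> K" for k
  proof
    fix f assume f: "f \<in> B k"
    have "(\<Sum>i\<in>S. (f i)\<^sup>2) \<le> (\<Sum>i\<in>S. (real (k i))\<^sup>2)"
    proof (rule sum_mono)
      fix i assume "i \<in> S"
      with f have "\<bar>f i\<bar> \<le> \<bar>real (k i)\<bar>" by (fastforce simp: B_def dest: PiE_mem)
      thus "(f i)\<^sup>2 \<le> (real (k i))\<^sup>2" by (simp only: abs_le_square_iff)
    qed
    also have "\<dots> = (knorm k)\<^sup>2" using that by (simp add: knorm_support K_def)
    also have "\<dots> \<le> r\<^sup>2" using that by (intro power_mono) (auto simp: K_def)
    finally have "sqrt (\<Sum>i\<in>S. (f i)\<^sup>2) \<le> r" using assms by (simp add: real_le_lsqrt sum_nonneg)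
    thus "f \<in> C" using f by (auto simp: C_def P_def space_PiM B_def)
  qed
  have C: "emeasure P C = ennreal (unit_ball_vol (real (card S)) * r ^ card S)"
    unfolding C_def P_def by (rule emeasure_cball_aux) (use assms in auto)
  have "ennreal (\<Sum>k\<in>K. 2 ^ card S) = (\<Sum>k\<in>K. emeasure P (B k))"
    by (subst sum_ennreal[symmetric]) (auto intro!: sum.cong simp: em)
  also have "\<dots> = emeasure P (\<Union>k\<in>K. B k)"
    using sets_B by (intro sum_emeasure disj finK) auto
  also have "\<dots> \<le> emeasure P C"
    using sub unfolding C_def P_def by (intro emeasure_mono) (auto intro: measurable)
  finally show ?thesis unfolding C K_def using assms by (subst (asm) ennreal_le_iff) auto
qed

text \<open>An empty index set makes the left side 0. Otherwise some multi-index with support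
  \<open>S\<close> has norm below r, so r is at least \<open>sqrt (card S)\<close>; the volume bound
  leaves the decreasing power of r with exponent -(d - l), l = \<open>card S\<close>, which is
  largest at that smallest radius.\<close>

lemma sum_support_scaled_le:
  fixes S :: "'n::finite set"
  assumes "r > 0" "S \<noteq> {}"
  shows "r powr (- real CARD('n)) * (\<Sum>k | {i. k i \<noteq> 0} = S \<and> knorm k < r. 2 ^ card S)
     \<le> unit_ball_vol (real (card S)) / real (card S) powr ((real CARD('n) - real (card S)) / 2)"
proof (cases "{k. {i. k i \<noteq> 0} = S \<and> knorm k < r} = {}")
  case True
  show ?thesis unfolding True by simp
next
  case False
  let ?l = "card S" and ?d = "CARD('n)"
  have l: "?l > 0" "?l \<le> ?d" using assms(2) by (auto simp: card_gt_0_iff card_mono)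
  from False obtain k where "{i. k i \<noteq> 0} = S" "knorm k < r" by blast
  hence r: "sqrt (real ?l) \<le> r" using sqrt_support_le_knorm[of k] by (simp add: nzcount_def)
  have "r powr (- real ?d) * (\<Sum>k | {i. k i \<noteq> 0} = S \<and> knorm k < r. 2 ^ card S)
     \<le> r powr (- real ?d) * (unit_ball_vol (real ?l) * r ^ ?l)"
    using sum_support_le_ball[OF assms(1)] by (intro mult_left_mono) auto
  also have "\<dots> = unit_ball_vol (real ?l) * r powr (- (real ?d - real ?l))"
    using assms(1) by (simp add: powr_diff powr_minus powr_realpow field_simps)
  also have "\<dots> \<le> unit_ball_vol (real ?l) * sqrt (real ?l) powr (- (real ?d - real ?l))"
    using r l by (intro mult_left_mono powr_mono2') auto
  also have "sqrt (real ?l) powr (- (real ?d - real ?l)) = 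
     1 / real ?l powr ((real ?d - real ?l) / 2)"
    using l by (simp add: powr_half_sqrt[symmetric] powr_powr powr_minus_divide[symmetric] minus_divide_left)
  finally show ?thesis by simp
qed

text \<open>The sum is grouped by support. Positive norm excludes exactly the empty support, and the
  bound for one support depends only on its size, which produces the binomial coefficient.\<close>

lemma lattice_sum_le:
  assumes "r > 0"
  shows "r powr (- real CARD('n)) * (\<Sum>k\<in>{k::'n::finite \<Rightarrow> nat. 0 < knorm k \<and> knorm k < r}. 2 ^ nzcount k)
    \<le> (\<Sum>l=1..CARD('n). real (CARD('n) choose l) * unit_ball_vol (real l)
                                    / real l powr ((real CARD('n) - real l) / 2))"
proof -
  let ?d = "CARD('n)"
  define K where "K = {k::'n \<Rightarrow> nat. 0 < knorm k \<and> knorm k < r}"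
  define c where "c l = unit_ball_vol (real l) / real l powr ((real ?d - real l) / 2)" for l
  define T where "T = {S::'n set. S \<noteq> {}}"
  have pos_iff: "0 < knorm k \<longleftrightarrow> {i. k i \<noteq> 0} \<noteq> {}" for k :: "'n \<Rightarrow> nat"
  proof -
    have "0 < knorm k \<longleftrightarrow> (knorm k)\<^sup>2 \<noteq> 0" using knorm_nonneg[of k] by (simp add: less_le)
    also have "\<dots> \<longleftrightarrow> {i. k i \<noteq> 0} \<noteq> {}" by (simp add: knorm_support sum_nonneg_eq_0_iff)
    finally show ?thesis .
  qed
  have finK: "finite K" unfolding K_def by (rule finite_subset[OF _ finite_knorm_less[of r]]) auto
  have "(\<Sum>k\<in>K. 2 ^ nzcount k :: real) = (\<Sum>S\<in>T. \<Sum>k | k \<in> K \<and> {i. k i \<noteq> 0} = S. 2 ^ nzcount k)"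
    using finK by (intro sum.group[symmetric]) (auto simp: T_def K_def pos_iff)
  also have "\<dots> = (\<Sum>S\<in>T. \<Sum>k | {i. k i \<noteq> 0} = S \<and> knorm k < r. 2 ^ card S)"
    by (intro sum.cong refl) (auto simp: K_def T_def pos_iff nzcount_def)
  finally have "r powr (- real ?d) * (\<Sum>k\<in>K. 2 ^ nzcount k) = 
     (\<Sum>S\<in>T. r powr (- real ?d) * (\<Sum>k | {i. k i \<noteq> 0} = S \<and> knorm k < r. 2 ^ card S))"
    by (simp add: sum_distrib_left)
  also have "\<dots> \<le> (\<Sum>S\<in>T. c (card S))"
    unfolding c_def using assms by (intro sum_mono sum_support_scaled_le) (auto simp: T_def)
  also have "\<dots> = (\<Sum>l=1..?d. \<Sum>S | S \<in> T \<and> card S = l. c (card S))"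
    by (rule sum.group[symmetric]) (auto simp: T_def card_gt_0_iff Suc_le_eq card_mono)
  also have "\<dots> = (\<Sum>l=1..?d. real (?d choose l) * c l)"
  proof (rule sum.cong[OF refl])
    fix l assume l: "l \<in> {1..?d}"
    have "{S. S \<in> T \<and> card S = l} = {S. S \<subseteq> (UNIV::'n set) \<and> card S = l}"
      using l by (auto simp: T_def)
    hence "card {S. S \<in> T \<and> card S = l} = ?d choose l" using n_subsets[of "UNIV::'n set" l] by simp
    thus "(\<Sum>S | S \<in> T \<and> card S = l. c (card S)) = real (?d choose l) * c l" by simp
  qed
  finally show ?thesis by (simp add: K_def c_def)
qed

section \<open>The constant as a positive real number\<close>

lemma Nd_le:
  "Nd TYPE('n::finite) \<le> ereal (\<Sum>l=1..CARD('n). real (CARD('n) choose l) * unit_ball_vol (real l)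
                                    / real l powr ((real CARD('n) - real l) / 2))"
  unfolding Nd_def by (rule SUP_least) (use lattice_sum_le in auto)

text \<open>This ensures that \<open>real_of_ereal\<close> returns the true value of
  \<open>Nd\<close>. One member of the family, at r = 1, bounds the supremum below by a finite
  number.\<close>

lemma Nd_finite: "\<bar>Nd TYPE('n::finite)\<bar> \<noteq> \<infinity>"
proof -
  have "ereal (1 powr (- real CARD('n)) * (\<Sum>k\<in>{k::'n \<Rightarrow> nat. 0 < knorm k \<and> knorm k < 1}. 2 ^ nzcount k)) \<le> Nd TYPE('n)"
    unfolding Nd_def by (rule SUP_upper) auto
  with Nd_le[where 'n='n] show ?thesis by (cases "Nd TYPE('n)") auto
qed

lemma lattice_sum_le_Nd:
  assumes "r > 0"
  shows "(\<Sum>k\<in>{k::'n::finite \<Rightarrow> nat. 0 < knorm k \<and> knorm k < r}. 2 ^ nzcount k)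
     \<le> real_of_ereal (Nd TYPE('n)) * r ^ CARD('n)"
proof -
  have "ereal (r powr (- real CARD('n)) * (\<Sum>k\<in>{k::'n \<Rightarrow> nat. 0 < knorm k \<and> knorm k < r}. 2 ^ nzcount k)) \<le> Nd TYPE('n)"
    unfolding Nd_def by (rule SUP_upper) (use assms in auto)
  also have "Nd TYPE('n) = ereal (real_of_ereal (Nd TYPE('n)))"
    using Nd_finite[where 'n='n] by (simp add: ereal_real')
  finally show ?thesis using assms by (simp add: powr_minus powr_realpow field_simps)
qed

lemma Nd_pos: "0 < real_of_ereal (Nd TYPE('n::finite))"
proof -
  \<comment> \<open>A unit multi-index in an arbitrary coordinate. Its norm is 1, so it is counted
    at r = 2, the norm condition being strict.\<close>
  define k :: "'n \<Rightarrow> nat" where "k = (\<lambda>i. if i = undefined then 1 else 0)"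
  have "(knorm k)\<^sup>2 = 1" by (simp add: knorm_support k_def)
  hence k: "knorm k = 1" using knorm_nonneg[of k] by (simp add: power2_eq_1_iff)
  have "0 < (2::real) ^ nzcount k" by simp
  also have "\<dots> \<le> (\<Sum>k\<in>{k::'n::finite \<Rightarrow> nat. 0 < knorm k \<and> knorm k < 2}. 2 ^ nzcount k)"
    using k by (intro member_le_sum finite_subset[OF _ finite_knorm_less[of 2]]) auto
  also have "\<dots> \<le> real_of_ereal (Nd TYPE('n)) * 2 ^ CARD('n)" by (rule lattice_sum_le_Nd) auto
  finally show ?thesis by (simp add: zero_less_mult_iff)
qed


section \<open>Smooth cutoffs and test functions\<close>

text \<open>The functions exp(-1/t)/t^n, extended by 0. Derivatives of the classical flat function
  exp(-1/t) are linear combinations of these, so carrying the power as an index closes the family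
  under differentiation.\<close>

definition flat :: "nat \<Rightarrow> real \<Rightarrow> real" where
  "flat n t = (if t > 0 then exp (- 1 / t) / t ^ n else 0)"

lemma flat_nonneg: "0 \<le> flat n t"
  by (simp add: flat_def)

lemma flat_Suc: "t * flat (Suc n) t = flat n t"
  by (simp add: flat_def)

lemma flat_0_le: "flat 0 t \<le> 1"
  by (simp add: flat_def)

text \<open>Explicit bounds on \<open>flat 1\<close> and \<open>flat 2\<close> will give a majorant
  for the derivative of the cutoff that does not depend on its width.\<close>

lemma flat_1_le: "flat 1 t \<le> 1"
proof (cases "t > 0")
  case True
  have "1 / t \<le> exp (1 / t)" using exp_ge_add_one_self[of "1 / t"] by linarith
  with True show ?thesis by (simp add: flat_def exp_minus field_simps)
qed (simp add: flat_def)

lemma flat_2_le: "flat 2 t \<le> 2"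
proof (cases "t > 0")
  case True
  have "1 + 1 / t + (1 / t)\<^sup>2 / 2 \<le> exp (1 / t)" 
    using True by (intro exp_lower_Taylor_quadratic) auto
  hence "(1 / t)\<^sup>2 \<le> 2 * exp (1 / t)" using True divide_pos_pos[OF zero_less_one True] by linarith
  with True show ?thesis by (simp add: flat_def exp_minus field_simps power2_eq_square)
qed (simp add: flat_def)

lemma flat_tendsto_0: "(flat n \<longlongrightarrow> 0) (at 0)"
proof -
  have "((\<lambda>t. inverse t ^ n / exp (inverse t)) \<longlongrightarrow> 0) (at_right (0::real))"
    by (rule filterlim_compose[OF tendsto_power_div_exp_0 filterlim_inverse_at_top_right])
  hence "(flat n \<longlongrightarrow> 0) (at_right 0)"
    by (rule Lim_transform_eventually)
       (auto simp: eventually_at_filter flat_def exp_minus field_simps)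
  moreover have "(flat n \<longlongrightarrow> 0) (at_left 0)"
    by (rule Lim_transform_eventually[OF tendsto_const])
       (auto simp: eventually_at_filter flat_def)
  ultimately show ?thesis by (simp add: filterlim_split_at)
qed

lemma flat_has_derivative:
  "(flat n has_real_derivative flat (n + 2) t - real n * flat (n + 1) t) (at t)"
proof -
  consider "t > 0" | "t < 0" | "t = 0" by linarith
  thus ?thesis
  proof cases
    case 1
    have "((\<lambda>t. exp (- 1 / t) / t ^ n) has_real_derivative 
         flat (n + 2) t - real n * flat (n + 1) t) (at t)"
    proof (cases n)
      case 0
      show ?thesis unfolding 0 using 1
        by (auto intro!: derivative_eq_intros simp: flat_def power2_eq_square)
    next
      case (Suc m)
      show ?thesis unfolding Suc using 1
        by (auto intro!: derivative_eq_intros simp: flat_def power2_eq_square field_simps simp del: power_Suc)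
           (auto simp: field_simps)
    qed
    thus ?thesis
      by (rule has_field_derivative_transform_within_open[of _ _ _ "{0<..}"]) (use 1 in \<open>auto simp: flat_def\<close>)
  next
    case 2
    have "((\<lambda>t. 0) has_real_derivative flat (n + 2) t - real n * flat (n + 1) t) (at t)"
      using 2 by (simp add: flat_def)
    thus ?thesis
      by (rule has_field_derivative_transform_within_open[of _ _ _ "{..<0}"]) (use 2 in \<open>auto simp: flat_def\<close>)
  next
    case 3
    \<comment> \<open>At the origin the difference quotient of \<open>flat n\<close> is
      \<open>flat (Suc n)\<close>, whose limit there is 0.\<close>
    have "((\<lambda>h. (flat n (0 + h) - flat n 0) / h) \<longlongrightarrow> 0) (at 0)"
      by (rule Lim_transform_eventually[OF flat_tendsto_0[of "Suc n"]])
         (auto simp: eventually_at_filter flat_def)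
    thus ?thesis by (simp add: 3 DERIV_def) (simp add: flat_def)
  qed
qed

lemma flat_affine_has_derivative:
  "((\<lambda>t. flat n (a * t + b)) has_real_derivative 
     a * (flat (n + 2) (a * t + b) - real n * flat (n + 1) (a * t + b))) (at t)"
  by (rule DERIV_cong[OF DERIV_chain'[where f="\<lambda>t. a * t + b" and g="flat n" and D=a, OF _ flat_has_derivative]])
     (auto intro!: derivative_eq_intros)

text \<open>\<open>smooth\<close> speaks about partial derivatives of every order. A concrete class
  of one-variable functions, closed under differentiation and containing the cutoffs and the
  trigonometric factors, reduces this to an induction.\<close>

inductive_set smooth_alg :: "(real \<Rightarrow> real) set" where
  const: "(\<lambda>t. c) \<in> smooth_alg"
| flat: "(\<lambda>t. flat n (a * t + b)) \<in> smooth_alg"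
| sin: "(\<lambda>t. sin (a * t)) \<in> smooth_alg"
| cos: "(\<lambda>t. cos (a * t)) \<in> smooth_alg"
| add: "f \<in> smooth_alg \<Longrightarrow> g \<in> smooth_alg \<Longrightarrow> (\<lambda>t. f t + g t) \<in> smooth_alg"
| mult: "f \<in> smooth_alg \<Longrightarrow> g \<in> smooth_alg \<Longrightarrow> (\<lambda>t. f t * g t) \<in> smooth_alg"

lemma smooth_alg_derivative:
  assumes "f \<in> smooth_alg"
  shows "\<exists>f'\<in>smooth_alg. \<forall>t. (f has_real_derivative f' t) (at t)"
  using assms
proof induction
  case (const c)
  show ?case by (rule bexI[OF _ smooth_alg.const[of 0]]) auto
next
  case (flat n a b)
  have "(\<lambda>t. a * (flat (n + 2) (a * t + b) + (- real n) * flat (n + 1) (a * t + b))) \<in> smooth_alg"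
    by (intro smooth_alg.intros)
  moreover have "((\<lambda>t. flat n (a * t + b)) has_real_derivative 
     a * (flat (n + 2) (a * t + b) + (- real n) * flat (n + 1) (a * t + b))) (at t)" for t
    using flat_affine_has_derivative[of n a b t] by simp
  ultimately show ?case by (intro bexI[where x = "\<lambda>t. a * (flat (n + 2) (a * t + b) + (- real n) * flat (n + 1) (a * t + b))"]) auto
next
  case (sin a)
  show ?case by (rule bexI[OF _ smooth_alg.mult[OF smooth_alg.const[of a] smooth_alg.cos[of a]]]) (auto intro!: derivative_eq_intros)
next
  case (cos a)
  show ?case by (rule bexI[OF _ smooth_alg.mult[OF smooth_alg.const[of "-a"] smooth_alg.sin[of a]]]) (auto intro!: derivative_eq_intros)
next
  case (add f g)
  then obtain f' g' where "f' \<in> smooth_alg" "g' \<in> smooth_alg"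
     "\<forall>t. (f has_real_derivative f' t) (at t)" "\<forall>t. (g has_real_derivative g' t) (at t)" by blast
  thus ?case by (intro bexI[OF _ smooth_alg.add[of f' g']]) (auto intro!: derivative_eq_intros)
next
  case (mult f g)
  then obtain f' g' where *: "f' \<in> smooth_alg" "g' \<in> smooth_alg"
     "\<forall>t. (f has_real_derivative f' t) (at t)" "\<forall>t. (g has_real_derivative g' t) (at t)" by blast
  show ?case 
    by (rule bexI[OF _ smooth_alg.add[OF smooth_alg.mult[OF *(1) mult.hyps(2)] smooth_alg.mult[OF *(2) mult.hyps(1)]]])
       (use * in \<open>auto intro!: derivative_eq_intros\<close>)
qed

section \<open>Partial derivatives of products of one-variable functions\<close>

lemma has_derivative_prod_components:
  fixes a a' :: "'n::finite \<Rightarrow> real \<Rightarrow> real"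
  assumes "\<And>j t. (a j has_real_derivative a' j t) (at t)"
  shows "((\<lambda>x::real^'n. \<Prod>j\<in>UNIV. a j (x $ j)) has_derivative
     (\<lambda>h. \<Sum>i\<in>UNIV. a' i (x $ i) * (h $ i) * (\<Prod>j\<in>UNIV - {i}. a j (x $ j)))) (at x)"
proof (rule has_derivative_prod)
  fix j :: 'n
  have "((\<lambda>x::real^'n. x $ j) has_derivative (\<lambda>h. h $ j)) (at x)"
    by (rule bounded_linear_imp_has_derivative) (rule bounded_linear_vec_nth)
  from has_derivative_compose[OF this assms[of j "x $ j", unfolded has_field_derivative_def]]
  show "((\<lambda>x. a j (x $ j)) has_derivative (\<lambda>h. a' j (x $ j) * (h $ j))) (at x)" .
qed

lemma partial_prod_components:
  fixes a a' :: "'n::finite \<Rightarrow> real \<Rightarrow> real"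
  assumes "\<And>j t. (a j has_real_derivative a' j t) (at t)"
  shows "partial i (\<lambda>x::real^'n. \<Prod>j\<in>UNIV. a j (x $ j)) x = 
     a' i (x $ i) * (\<Prod>j\<in>UNIV - {i}. a j (x $ j))"
proof -
  have "partial i (\<lambda>x::real^'n. \<Prod>j\<in>UNIV. a j (x $ j)) x = 
     (\<Sum>l\<in>UNIV. a' l (x $ l) * (axis i 1 $ l) * (\<Prod>j\<in>UNIV - {l}. a j (x $ j)))"
    unfolding partial_def
    by (subst frechet_derivative_at[OF has_derivative_prod_components[of a a'], symmetric]) (use assms in auto)
  also have "\<dots> = (\<Sum>l\<in>{i}. a' l (x $ l) * (axis i 1 $ l) * (\<Prod>j\<in>UNIV - {l}. a j (x $ j)))"
    by (rule sum.mono_neutral_right) (auto simp: axis_def)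
  finally show ?thesis by (simp add: axis_def)
qed

text \<open>A partial derivative in direction \<open>i\<close> replaces the factor \<open>i\<close>
  by its derivative and leaves the others alone, so products with factors in
  \<open>smooth_alg\<close> are stable under \<open>iter_partial\<close>.\<close>

lemma smooth_prod_components:
  fixes a :: "'n::finite \<Rightarrow> real \<Rightarrow> real"
  assumes "\<And>j. a j \<in> smooth_alg"
  shows "smooth (\<lambda>x::real^'n. \<Prod>j\<in>UNIV. a j (x $ j))"
proof -
  let ?P = "\<lambda>a (x::real^'n). \<Prod>j\<in>(UNIV::'n set). a j (x $ j) :: real"
  have diff: "?P a differentiable (at x) \<and> (\<exists>b. (\<forall>j. b j \<in> smooth_alg) \<and> partial i (?P a) = ?P b)"
    if a: "\<And>j. a j \<in> smooth_alg" for a i x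
  proof -
    from a have "\<forall>j. \<exists>f'. f' \<in> smooth_alg \<and> (\<forall>t. (a j has_real_derivative f' t) (at t))"
      using smooth_alg_derivative by blast
    then obtain a' where a': "\<And>j. a' j \<in> smooth_alg" "\<And>j t. (a j has_real_derivative a' j t) (at t)"
      by metis
    have "partial i (?P a) x = ?P (a(i := a' i)) x" for x
    proof -
      have "?P (a(i := a' i)) x = (a(i := a' i)) i (x $ i) * (\<Prod>j\<in>UNIV - {i}. (a(i := a' i)) j (x $ j))"
        by (rule prod.remove) auto
      also have "(\<Prod>j\<in>UNIV - {i}. (a(i := a' i)) j (x $ j)) = (\<Prod>j\<in>UNIV - {i}. a j (x $ j))"
        by (intro prod.cong) auto
      finally show ?thesis using partial_prod_components[where a=a and a'=a' and i=i and x=x, OF a'(2)] by simp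
    qed
    moreover have "?P a differentiable (at x)"
      by (rule differentiableI[OF has_derivative_prod_components[where a=a and a'=a' and x=x, OF a'(2)]])
    ultimately show ?thesis using a a'(1) by (intro conjI exI[of _ "a(i := a' i)"]) (auto simp: fun_eq_iff)
  qed
  have iter: "\<exists>b. (\<forall>j. b j \<in> smooth_alg) \<and> iter_partial is (?P a) = ?P b" for "is"
  proof (induction "is")
    case Nil
    thus ?case using assms by auto
  next
    case (Cons i "is")
    then obtain b where "\<forall>j. b j \<in> smooth_alg" "iter_partial is (?P a) = ?P b" by blast
    thus ?case using diff[of b _ i] by auto
  qed
  show ?thesis unfolding smooth_def
  proof (intro allI)
    fix "is" x
    obtain b where "\<forall>j. b j \<in> smooth_alg" "iter_partial is (?P a) = ?P b" using iter by blast
    thus "iter_partial is (?P a) differentiable (at x)" using diff[of b x] by simp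
  qed
qed

text \<open>For e > 0 this is exp(-e/(t - e)) exp(-e/(1 - e - t)) on the interval (e, 1 - e) and 0
  outside. It stays below 1 but tends to 1 pointwise as e tends to 0, and its derivative is
  explicit.\<close>

definition cutoff :: "real \<Rightarrow> real \<Rightarrow> real" where
  "cutoff e t = flat 0 (1 / e * t + (- 1)) * flat 0 ((- 1 / e) * t + (1 - e) / e)"

definition cutoff' :: "real \<Rightarrow> real \<Rightarrow> real" where
  "cutoff' e t = 1 / e * flat 2 (1 / e * t + (- 1)) * flat 0 ((- 1 / e) * t + (1 - e) / e)
     - 1 / e * flat 0 (1 / e * t + (- 1)) * flat 2 ((- 1 / e) * t + (1 - e) / e)"

lemma cutoff_smooth_alg: "cutoff e \<in> smooth_alg"
  using smooth_alg.mult[OF smooth_alg.flat[of 0 "1 / e" "- 1"] smooth_alg.flat[of 0 "- 1 / e" "(1 - e) / e"]]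
  by (simp add: cutoff_def[abs_def])

lemma cutoff_has_derivative: "(cutoff e has_real_derivative cutoff' e t) (at t)"
  unfolding cutoff_def[abs_def]
  by (rule DERIV_cong[OF DERIV_mult[OF flat_affine_has_derivative flat_affine_has_derivative]])
     (simp add: cutoff'_def algebra_simps numeral_2_eq_2)

lemma cutoff_bounds: "0 \<le> cutoff e t" "cutoff e t \<le> 1"
  unfolding cutoff_def by (auto intro!: mult_nonneg_nonneg mult_le_one flat_nonneg flat_0_le)

lemma cutoff_eq_0:
  assumes "e > 0" "t \<le> e \<or> 1 - e \<le> t"
  shows "cutoff e t = 0"
proof -
  have "1 / e * t + (- 1) \<le> 0 \<or> (- 1 / e) * t + (1 - e) / e \<le> 0"
  proof (cases "t \<le> e")
    case False
    have "(- 1 / e) * t + (1 - e) / e = (1 - e - t) / e" using assms by (simp add: field_simps)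
    also have "\<dots> \<le> 0" using assms False by (intro divide_nonpos_pos) auto
    finally show ?thesis ..
  qed (use assms in \<open>simp add: field_simps\<close>)
  thus ?thesis unfolding cutoff_def flat_def by auto
qed

text \<open>The bound is uniform in e. With t = e(1 + w) and 1 - t = e(1 + z), the linear decay of s
  at the two ends cancels the factor 1/e, leaving c times
  \<open>(1 + w) * flat 2 w = flat 2 w + flat 1 w\<close>, at most 3, and the same in z. The two
  ends add up to 6.\<close>

lemma cutoff'_bound:
  assumes e: "e > 0" and t: "0 < t" "t < 1"
    and s: "\<bar>s\<bar> \<le> c * t" "\<bar>s\<bar> \<le> c * (1 - t)"
  shows "\<bar>s * cutoff' e t\<bar> \<le> 6 * c"
proof -
  have c: "c \<ge> 0" using s(1) t by (meson abs_ge_zero order_trans zero_le_mult_iff not_le)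
  define w where "w = 1 / e * t + (- 1)"
  define z where "z = (- 1 / e) * t + (1 - e) / e"
  have we: "t = e * (1 + w)" and ze: "1 - t = e * (1 + z)" using e by (auto simp: w_def z_def field_simps)
  have 3: "(1 + w) * flat 2 w \<le> 3" for w
    using flat_Suc[of w 1] flat_1_le[of w] flat_2_le[of w] by (simp add: algebra_simps numeral_2_eq_2)
  have "\<bar>s * (1 / e * flat 2 w * flat 0 z)\<bar> = \<bar>s\<bar> * (1 / e * flat 2 w * flat 0 z)"
    using e by (simp add: abs_mult flat_nonneg)
  also have "\<dots> \<le> (c * t) * (1 / e * flat 2 w * 1)"
    using e t c s by (intro mult_mono mult_nonneg_nonneg flat_nonneg flat_0_le) auto
  also have "\<dots> = c * ((1 + w) * flat 2 w)" unfolding we using e by simp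
  also have "\<dots> \<le> c * 3" using c 3 by (intro mult_left_mono) auto
  finally have A: "\<bar>s * (1 / e * flat 2 w * flat 0 z)\<bar> \<le> c * 3" .
  have "\<bar>s * (1 / e * flat 0 w * flat 2 z)\<bar> = \<bar>s\<bar> * (1 / e * 1 * flat 2 z) * flat 0 w"
    using e by (simp add: abs_mult flat_nonneg)
  also have "\<dots> \<le> (c * (1 - t)) * (1 / e * 1 * flat 2 z) * 1"
    using e t c s by (intro mult_mono mult_nonneg_nonneg flat_nonneg flat_0_le) auto
  also have "\<dots> = c * ((1 + z) * flat 2 z)" unfolding ze using e by simp
  also have "\<dots> \<le> c * 3" using c 3 by (intro mult_left_mono) auto
  finally have B: "\<bar>s * (1 / e * flat 0 w * flat 2 z)\<bar> \<le> c * 3" .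
  have "s * cutoff' e t = s * (1 / e * flat 2 w * flat 0 z) - s * (1 / e * flat 0 w * flat 2 z)"
    by (simp add: cutoff'_def w_def z_def algebra_simps)
  hence "\<bar>s * cutoff' e t\<bar> \<le> \<bar>s * (1 / e * flat 2 w * flat 0 z)\<bar> + \<bar>s * (1 / e * flat 0 w * flat 2 z)\<bar>"
    by (simp only: abs_triangle_ineq4)
  with A B show ?thesis by linarith
qed

lemma cutoff_tendsto:
  assumes t: "0 < t" "t < 1"
  shows "((\<lambda>e. cutoff e t) \<longlongrightarrow> 1) (at_right 0)" "((\<lambda>e. cutoff' e t) \<longlongrightarrow> 0) (at_right 0)"
proof -
  have ev: "eventually (\<lambda>e::real. 0 < e \<and> e < t \<and> e < 1 - t) (at_right 0)"
    using t by (intro eventually_conj eventually_at_right_less order_tendstoD[OF tendsto_ident_at]) auto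
  have a: "((\<lambda>e. exp (- (e / (t - e)))) \<longlongrightarrow> 1) (at_right 0)"
    using t by (auto intro!: tendsto_eq_intros)
  have b: "((\<lambda>e. exp (- (e / (1 - t - e)))) \<longlongrightarrow> 1) (at_right 0)"
    using t by (auto intro!: tendsto_eq_intros)
  have a': "((\<lambda>e. exp (- (e / (t - e))) * (e / (t - e)\<^sup>2)) \<longlongrightarrow> 0) (at_right 0)"
    using t by (auto intro!: tendsto_eq_intros)
  have b': "((\<lambda>e. exp (- (e / (1 - t - e))) * (e / (1 - t - e)\<^sup>2)) \<longlongrightarrow> 0) (at_right 0)"
    using t by (auto intro!: tendsto_eq_intros)
  \<comment> \<open>\<open>flat 2\<close> contributes e^2 in the numerator and the prefactor removes
    only one power of e. The power that is left sends the derivative to 0 at a fixed interior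
    point.\<close>
  have eq: "flat 0 (1 / e * t + (- 1)) = exp (- (e / (t - e)))"
       "flat 0 ((- 1 / e) * t + (1 - e) / e) = exp (- (e / (1 - t - e)))"
       "1 / e * flat 2 (1 / e * t + (- 1)) = exp (- (e / (t - e))) * (e / (t - e)\<^sup>2)"
       "1 / e * flat 2 ((- 1 / e) * t + (1 - e) / e) = exp (- (e / (1 - t - e))) * (e / (1 - t - e)\<^sup>2)"
     if "0 < e \<and> e < t \<and> e < 1 - t" for e
  proof -
    have 1: "1 / e * t + (- 1) = (t - e) / e" "(- 1 / e) * t + (1 - e) / e = (1 - t - e) / e"
      using that by (auto simp: field_simps)
    have 2: "(t - e) / e > 0" "(1 - t - e) / e > 0" using that by auto
    show "flat 0 (1 / e * t + (- 1)) = exp (- (e / (t - e)))"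
       "flat 0 ((- 1 / e) * t + (1 - e) / e) = exp (- (e / (1 - t - e)))"
       "1 / e * flat 2 (1 / e * t + (- 1)) = exp (- (e / (t - e))) * (e / (t - e)\<^sup>2)"
       "1 / e * flat 2 ((- 1 / e) * t + (1 - e) / e) = exp (- (e / (1 - t - e))) * (e / (1 - t - e)\<^sup>2)"
      unfolding 1 flat_def using 2 that by (simp_all add: power_divide power2_eq_square)
  qed
  show "((\<lambda>e. cutoff e t) \<longlongrightarrow> 1) (at_right 0)"
    by (rule Lim_transform_eventually[OF tendsto_mult[OF a b, simplified]])
       (use ev in eventually_elim, simp only: cutoff_def eq)
  have "((\<lambda>e. exp (- (e / (t - e))) * (e / (t - e)\<^sup>2) * exp (- (e / (1 - t - e)))
     - exp (- (e / (1 - t - e))) * (e / (1 - t - e)\<^sup>2) * exp (- (e / (t - e)))) \<longlongrightarrow> 0) (at_right 0)"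
    using tendsto_diff[OF tendsto_mult[OF a' b] tendsto_mult[OF b' a]] by simp
  thus "((\<lambda>e. cutoff' e t) \<longlongrightarrow> 0) (at_right 0)"
  proof (rule Lim_transform_eventually)
    show "eventually (\<lambda>e. exp (- (e / (t - e))) * (e / (t - e)\<^sup>2) * exp (- (e / (1 - t - e)))
     - exp (- (e / (1 - t - e))) * (e / (1 - t - e)\<^sup>2) * exp (- (e / (t - e))) = cutoff' e t) (at_right 0)"
      using ev
    proof eventually_elim
      case (elim e)
      have "cutoff' e t = (1 / e * flat 2 (1 / e * t + (- 1))) * flat 0 ((- 1 / e) * t + (1 - e) / e)
     - (1 / e * flat 2 ((- 1 / e) * t + (1 - e) / e)) * flat 0 (1 / e * t + (- 1))"
        by (simp add: cutoff'_def)
      thus ?case unfolding eq[OF elim] ..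
    qed
  qed
qed

lemma test_fun_cutoff:
  fixes b :: "'n::finite \<Rightarrow> real \<Rightarrow> real"
  assumes "\<And>j. b j \<in> smooth_alg" "0 < e"
  shows "test_fun (box 0 1) (\<lambda>x::real^'n. \<Prod>j\<in>UNIV. b j (x $ j) * cutoff e (x $ j))"
proof -
  let ?\<phi> = "\<lambda>x::real^'n. \<Prod>j\<in>UNIV. b j (x $ j) * cutoff e (x $ j)"
  let ?C = "cbox (\<chi> j. e) (\<chi> j. 1 - e) :: (real^'n) set"
  have "smooth ?\<phi>"
    by (rule smooth_prod_components[of "\<lambda>j t. b j t * cutoff e t"])
       (intro smooth_alg.mult assms cutoff_smooth_alg)
  moreover have "{x. ?\<phi> x \<noteq> 0} \<subseteq> ?C"
  proof
    fix x assume "x \<in> {x. ?\<phi> x \<noteq> 0}"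
    hence "cutoff e (x $ j) \<noteq> 0" for j by simp
    hence "e < x $ j \<and> x $ j < 1 - e" for j using cutoff_eq_0[OF assms(2), of "x $ j"] by fastforce
    thus "x \<in> ?C" by (simp add: mem_box_cart less_imp_le)
  qed
  hence "closure {x. ?\<phi> x \<noteq> 0} \<subseteq> ?C" by (rule closure_minimal) auto
  moreover from this have "compact (closure {x. ?\<phi> x \<noteq> 0})"
    unfolding compact_eq_bounded_closed by (intro conjI closed_closure bounded_subset[OF bounded_cbox])
  moreover have "?C \<subseteq> box 0 1"
  proof
    fix x assume "x \<in> ?C"
    hence "e \<le> x $ j \<and> x $ j \<le> 1 - e" for j by (simp add: mem_box_cart)
    hence "0 < x $ j \<and> x $ j < 1" for j using assms(2) by (smt (verit, best))
    thus "x \<in> box 0 1" by (simp add: mem_box_cart)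
  qed
  ultimately show ?thesis unfolding test_fun_def by (meson order_trans)
qed


section \<open>Orthonormal trigonometric systems on the cube\<close>

lemma integrable_mult_L2:
  fixes f g :: "'a \<Rightarrow> real"
  assumes [measurable]: "f \<in> borel_measurable M" "g \<in> borel_measurable M"
    and int: "integrable M (\<lambda>x. (f x)\<^sup>2)" "integrable M (\<lambda>x. (g x)\<^sup>2)"
  shows "integrable M (\<lambda>x. f x * g x)"
proof (rule Bochner_Integration.integrable_bound)
  show "integrable M (\<lambda>x. (f x)\<^sup>2 + (g x)\<^sup>2)" using int by simp
  show "AE x in M. norm (f x * g x) \<le> norm ((f x)\<^sup>2 + (g x)\<^sup>2)"
  proof (rule AE_I2)
    fix x
    have "0 \<le> (\<bar>f x\<bar> - \<bar>g x\<bar>)\<^sup>2" by simp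
    hence "2 * (\<bar>f x\<bar> * \<bar>g x\<bar>) \<le> (f x)\<^sup>2 + (g x)\<^sup>2" by (simp add: power2_diff)
    moreover have "0 \<le> \<bar>f x\<bar> * \<bar>g x\<bar>" by simp
    ultimately have "\<bar>f x\<bar> * \<bar>g x\<bar> \<le> (f x)\<^sup>2 + (g x)\<^sup>2" by linarith
    thus "norm (f x * g x) \<le> norm ((f x)\<^sup>2 + (g x)\<^sup>2)" by (simp add: abs_mult)
  qed
qed measurable

lemma integrable_add_L2:
  fixes f g :: "'a \<Rightarrow> real"
  assumes "f \<in> borel_measurable M" "g \<in> borel_measurable M"
    "integrable M (\<lambda>x. (f x)\<^sup>2)" "integrable M (\<lambda>x. (g x)\<^sup>2)"
  shows "integrable M (\<lambda>x. (f x + g x)\<^sup>2)" "integrable M (\<lambda>x. (f x - g x)\<^sup>2)"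
  using assms integrable_mult_L2[OF assms] by (simp_all add: power2_sum power2_diff mult.assoc)

text \<open>The pointwise bound (a + b)^2 \<le> 2a^2 + 2b^2 stands in for the triangle inequality of
  the L^2 norm. Its factors 2 explain the fractions of e in \<open>eigfun_complete\<close>.\<close>

lemma integral_square_triangle:
  fixes f g h :: "'a \<Rightarrow> real"
  assumes [measurable]: "f \<in> borel_measurable M" "g \<in> borel_measurable M" "h \<in> borel_measurable M"
    and int: "integrable M (\<lambda>x. (f x - g x)\<^sup>2)" "integrable M (\<lambda>x. (g x - h x)\<^sup>2)"
  shows "(\<integral>x. (f x - h x)\<^sup>2 \<partial>M) \<le> 2 * (\<integral>x. (f x - g x)\<^sup>2 \<partial>M) + 2 * (\<integral>x. (g x - h x)\<^sup>2 \<partial>M)"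
proof -
  have le: "(f x - h x)\<^sup>2 \<le> 2 * (f x - g x)\<^sup>2 + 2 * (g x - h x)\<^sup>2" for x
  proof -
    have "0 \<le> ((f x - g x) - (g x - h x))\<^sup>2" by simp
    thus ?thesis by (simp add: power2_eq_square algebra_simps)
  qed
  have "integrable M (\<lambda>x. (f x - h x)\<^sup>2)"
    by (rule Bochner_Integration.integrable_bound[of _ "\<lambda>x. 2 * (f x - g x)\<^sup>2 + 2 * (g x - h x)\<^sup>2"])
       (use int le in auto)
  hence "(\<integral>x. (f x - h x)\<^sup>2 \<partial>M) \<le> (\<integral>x. 2 * (f x - g x)\<^sup>2 + 2 * (g x - h x)\<^sup>2 \<partial>M)"
    using int le by (intro integral_mono) auto
  also have "\<dots> = 2 * (\<integral>x. (f x - g x)\<^sup>2 \<partial>M) + 2 * (\<integral>x. (g x - h x)\<^sup>2 \<partial>M)"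
    using int by simp
  finally show ?thesis .
qed

definition orthonormal_on :: "'a measure \<Rightarrow> 'k set \<Rightarrow> ('k \<Rightarrow> 'a \<Rightarrow> real) \<Rightarrow> bool" where
  "orthonormal_on M K \<phi> \<longleftrightarrow> (\<forall>k\<in>K. \<phi> k \<in> borel_measurable M \<and> integrable M (\<lambda>x. (\<phi> k x)\<^sup>2)) \<and>
     (\<forall>k\<in>K. \<forall>m\<in>K. (\<integral>x. \<phi> k x * \<phi> m x \<partial>M) = (if k = m then 1 else 0))"

text \<open>Completing the square in the coefficients \<open>c\<close>. For the Fourier coefficients
  the last sum vanishes, which gives Bessel and the exact size of a remainder; for arbitrary
  \<open>c\<close> the identity says that the Fourier sum is the best approximation.\<close>

lemma integral_square_residual:
  fixes v :: "'a \<Rightarrow> real"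
  assumes K: "orthonormal_on M K \<phi>" and F: "finite F" "F \<subseteq> K"
    and v [measurable]: "v \<in> borel_measurable M" and v2: "integrable M (\<lambda>x. (v x)\<^sup>2)"
  shows "(\<integral>x. (v x - (\<Sum>k\<in>F. c k * \<phi> k x))\<^sup>2 \<partial>M)
     = (\<integral>x. (v x)\<^sup>2 \<partial>M) - (\<Sum>k\<in>F. (\<integral>x. v x * \<phi> k x \<partial>M)\<^sup>2) + (\<Sum>k\<in>F. (c k - (\<integral>x. v x * \<phi> k x \<partial>M))\<^sup>2)"
    and "integrable M (\<lambda>x. (v x - (\<Sum>k\<in>F. c k * \<phi> k x))\<^sup>2)"
proof -
  have \<phi>: "\<phi> k \<in> borel_measurable M" "integrable M (\<lambda>x. (\<phi> k x)\<^sup>2)" if "k \<in> F" for k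
    using that K F by (auto simp: orthonormal_on_def)
  have int1: "integrable M (\<lambda>x. v x * \<phi> k x)" if "k \<in> F" for k
    using that \<phi> v v2 by (intro integrable_mult_L2) auto
  have int2: "integrable M (\<lambda>x. \<phi> j x * \<phi> k x)" if "j \<in> F" "k \<in> F" for j k
    using that \<phi> by (intro integrable_mult_L2) auto
  define a where "a k = (\<integral>x. v x * \<phi> k x \<partial>M)" for k
  have expand: "(v x - (\<Sum>k\<in>F. c k * \<phi> k x))\<^sup>2 =
     (v x)\<^sup>2 - (\<Sum>k\<in>F. (2 * c k) * (v x * \<phi> k x)) + (\<Sum>j\<in>F. \<Sum>k\<in>F. (c j * c k) * (\<phi> j x * \<phi> k x))" for x
    by (simp add: power2_diff power2_eq_square[of "sum _ _"] sum_product sum_distrib_left mult_ac)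
  show int: "integrable M (\<lambda>x. (v x - (\<Sum>k\<in>F. c k * \<phi> k x))\<^sup>2)"
    unfolding expand using v2 int1 int2 by auto
  have "(\<integral>x. (v x - (\<Sum>k\<in>F. c k * \<phi> k x))\<^sup>2 \<partial>M) = (\<integral>x. (v x)\<^sup>2 \<partial>M) - (\<Sum>k\<in>F. (2 * c k) * a k)
     + (\<Sum>j\<in>F. \<Sum>k\<in>F. (c j * c k) * (\<integral>x. \<phi> j x * \<phi> k x \<partial>M))"
    unfolding expand a_def using v2 int1 int2 by (simp add: Bochner_Integration.integral_sum)
  also have "(\<Sum>j\<in>F. \<Sum>k\<in>F. (c j * c k) * (\<integral>x. \<phi> j x * \<phi> k x \<partial>M)) = (\<Sum>j\<in>F. \<Sum>k\<in>F. if j = k then (c j)\<^sup>2 else 0)"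
    using K F unfolding orthonormal_on_def by (intro sum.cong refl) (auto simp: power2_eq_square subset_iff)
  also have "\<dots> = (\<Sum>j\<in>F. (c j)\<^sup>2)" using F by simp
  also have "(\<integral>x. (v x)\<^sup>2 \<partial>M) - (\<Sum>k\<in>F. (2 * c k) * a k) + (\<Sum>j\<in>F. (c j)\<^sup>2) = 
     (\<integral>x. (v x)\<^sup>2 \<partial>M) - (\<Sum>k\<in>F. (a k)\<^sup>2) + (\<Sum>k\<in>F. (c k - a k)\<^sup>2)"
    by (simp add: power2_diff sum.distrib sum_subtractf)
  finally show "(\<integral>x. (v x - (\<Sum>k\<in>F. c k * \<phi> k x))\<^sup>2 \<partial>M)
     = (\<integral>x. (v x)\<^sup>2 \<partial>M) - (\<Sum>k\<in>F. (\<integral>x. v x * \<phi> k x \<partial>M)\<^sup>2) + (\<Sum>k\<in>F. (c k - (\<integral>x. v x * \<phi> k x \<partial>M))\<^sup>2)"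
    unfolding a_def .
qed

lemma Bessel_inequality:
  fixes v :: "'a \<Rightarrow> real"
  assumes "orthonormal_on M K \<phi>" "finite F" "F \<subseteq> K"
    "v \<in> borel_measurable M" "integrable M (\<lambda>x. (v x)\<^sup>2)"
  shows "(\<Sum>k\<in>F. (\<integral>x. v x * \<phi> k x \<partial>M)\<^sup>2) \<le> (\<integral>x. (v x)\<^sup>2 \<partial>M)"
proof -
  have "0 \<le> (\<integral>x. (v x - (\<Sum>k\<in>F. (\<integral>x. v x * \<phi> k x \<partial>M) * \<phi> k x))\<^sup>2 \<partial>M)" by simp
  thus ?thesis unfolding integral_square_residual(1)[OF assms] by simp
qed

text \<open>Turns the set integrals of \<open>W11_grad\<close> and \<open>G\<close> into plain
  integrals over a measure of total mass 1, to which the abstract L^2 lemmas apply and for which the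
  mean is the integral.\<close>

definition cube :: "(real^'n::finite) measure" where
  "cube = restrict_space lborel (box 0 1)"

lemma space_cube [simp]: "space cube = box 0 1"
  by (simp add: cube_def space_restrict_space)

lemma measurable_cube: "f \<in> borel_measurable borel \<Longrightarrow> f \<in> borel_measurable cube"
  unfolding cube_def by (rule measurable_restrict_space1) simp

lemma measurable_cube_iff:
  fixes f :: "real^'n::finite \<Rightarrow> real"
  shows "f \<in> borel_measurable cube \<longleftrightarrow> (\<lambda>x. indicator (box 0 1) x * f x) \<in> borel_measurable lborel"
  unfolding cube_def by (subst borel_measurable_restrict_space_iff) (auto simp: mult.commute)

lemma integrable_cube_iff:
  fixes f :: "real^'n::finite \<Rightarrow> real"
  shows "integrable cube f \<longleftrightarrow> set_integrable lborel (box 0 1) f"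
  unfolding cube_def set_integrable_def by (subst integrable_restrict_space) auto

lemma integral_cube:
  fixes f :: "real^'n::finite \<Rightarrow> real"
  shows "integral\<^sup>L cube f = (\<integral>x\<in>box 0 1. f x \<partial>lborel)"
  unfolding cube_def set_lebesgue_integral_def by (subst integral_restrict_space) auto

lemma nn_integral_cube:
  fixes f :: "real^'n::finite \<Rightarrow> ennreal"
  shows "integral\<^sup>N cube f = (\<integral>\<^sup>+x\<in>box 0 1. f x \<partial>lborel)"
  unfolding cube_def by (subst nn_integral_restrict_space) auto

lemma emeasure_unit_box: "emeasure lborel (box 0 (1::real^'n::finite)) = 1"
  by (subst emeasure_lborel_box) (auto simp: Basis_vec_def inner_axis prod.neutral)

lemma prob_space_cube: "emeasure (cube :: (real^'n::finite) measure) (space cube) = 1"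
  by (simp add: cube_def emeasure_restrict_space emeasure_unit_box)

lemma finite_measure_cube: "finite_measure (cube :: (real^'n::finite) measure)"
  by (rule finite_measureI) (simp only: prob_space_cube, simp)

lemma integrable_cube_bounded:
  fixes f :: "real^'n::finite \<Rightarrow> real"
  assumes "f \<in> borel_measurable cube" "\<And>x. x \<in> box 0 1 \<Longrightarrow> \<bar>f x\<bar> \<le> B"
  shows "integrable cube f"
  by (rule finite_measure.integrable_const_bound[OF finite_measure_cube, of _ B])
     (use assms in auto)

section \<open>Integrals of products over the coordinates\<close>

lemma integral_lborel_prod_components:
  fixes f :: "'n::finite \<Rightarrow> real \<Rightarrow> real"
  assumes int: "\<And>j. integrable lborel (f j)"
  shows "(\<integral>x. (\<Prod>j\<in>UNIV. f j ((x::real^'n) $ j)) \<partial>lborel) = (\<Prod>j\<in>UNIV. integral\<^sup>L lborel (f j))"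
proof -
  interpret product_sigma_finite "\<lambda>_::real^'n. lborel :: real measure" ..
  \<comment> \<open>\<open>lborel\<close> is the image of a product measure indexed by
    \<open>Basis\<close>, while the factors are indexed by coordinates; \<open>ix\<close> sends the
    unit vector \<open>axis j 1\<close> back to \<open>j\<close>.\<close>
  define ix :: "real^'n \<Rightarrow> 'n" where "ix = inv (\<lambda>j. axis j 1)"
  have inj: "inj (\<lambda>j::'n. axis j (1::real))" by (auto simp: inj_def axis_eq_axis)
  have ix: "ix (axis j 1) = j" for j unfolding ix_def by (rule inv_f_f[OF inj])
  have Basis: "(Basis :: (real^'n) set) = range (\<lambda>j. axis j 1)" by (auto simp: Basis_vec_def)
  have reindex: "(\<Prod>b\<in>Basis. g b) = (\<Prod>j\<in>UNIV. g (axis j 1))" for g :: "real^'n \<Rightarrow> real"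
    unfolding Basis by (subst prod.reindex[OF inj]) simp
  have comp: "(\<Sum>b\<in>Basis. y b *\<^sub>R b) $ j = y (axis j 1)" for y :: "real^'n \<Rightarrow> real" and j
  proof -
    have "(\<Sum>b\<in>Basis. y b *\<^sub>R b) $ j = (\<Sum>b\<in>Basis. y b *\<^sub>R b) \<bullet> axis j 1"
      by (simp add: inner_axis)
    also have "\<dots> = y (axis j 1)" by (rule inner_sum_left_Basis) (simp add: Basis)
    finally show ?thesis .
  qed
  have [measurable]: "f j \<in> borel_measurable borel" for j using int[of j] by (auto dest: borel_measurable_integrable)
  have "(\<integral>x. (\<Prod>j\<in>UNIV. f j ((x::real^'n) $ j)) \<partial>lborel) = 
     (\<integral>y. (\<Prod>j\<in>UNIV. f j ((\<Sum>b\<in>Basis. y b *\<^sub>R b) $ j)) \<partial>(\<Pi>\<^sub>M b\<in>(Basis::(real^'n) set). lborel))"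
    by (subst lborel_eq) (subst integral_distr, auto)
  also have "\<dots> = (\<integral>y. (\<Prod>b\<in>Basis. f (ix b) (y b)) \<partial>(\<Pi>\<^sub>M b\<in>(Basis::(real^'n) set). lborel))"
    by (simp only: comp reindex ix)
  also have "\<dots> = (\<Prod>b\<in>(Basis::(real^'n) set). integral\<^sup>L lborel (f (ix b)))"
    by (rule product_integral_prod) (use int in auto)
  also have "\<dots> = (\<Prod>j\<in>UNIV. integral\<^sup>L lborel (f j))" by (simp only: reindex ix)
  finally show ?thesis .
qed

lemma indicator_unit_box:
  "indicator (box 0 1) (x::real^'n::finite) = (\<Prod>j\<in>UNIV. indicator {0<..<1} (x $ j) :: real)"
proof (cases "x \<in> box 0 1")
  case False
  then obtain j where "x $ j \<notin> {0<..<1}" by (auto simp: mem_box_cart)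
  hence "indicator {0<..<1} (x $ j) = (0::real)" by (rule indicator_simps(2))
  hence "(\<Prod>j\<in>UNIV. indicator {0<..<1} (x $ j) :: real) = 0" by (intro prod_zero) auto
  with False show ?thesis by simp
qed (auto simp: mem_box_cart)

lemma integral_cube_prod_components:
  fixes f :: "'n::finite \<Rightarrow> real \<Rightarrow> real"
  assumes int: "\<And>j. set_integrable lborel {0<..<1} (f j)"
  shows "(\<integral>x. (\<Prod>j\<in>UNIV. f j (x $ j)) \<partial>cube) = (\<Prod>j\<in>UNIV. (\<integral>t\<in>{0<..<1}. f j t \<partial>lborel))"
proof -
  have "(\<integral>x. (\<Prod>j\<in>UNIV. f j (x $ j)) \<partial>cube) = 
     (\<integral>x. (\<Prod>j\<in>UNIV. indicator {0<..<1} ((x::real^'n) $ j) *\<^sub>R f j (x $ j)) \<partial>lborel)"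
    by (simp add: integral_cube set_lebesgue_integral_def indicator_unit_box prod.distrib)
  also have "\<dots> = (\<Prod>j\<in>UNIV. (\<integral>t\<in>{0<..<1}. f j t \<partial>lborel))"
    using int unfolding set_lebesgue_integral_def set_integrable_def
    by (rule integral_lborel_prod_components)
  finally show ?thesis .
qed

text \<open>The factor makes each function a unit vector of L^2(0,1), except for the sine of
  frequency 0, which vanishes and is excluded wherever orthonormality is claimed.\<close>

definition trig :: "bool \<Rightarrow> nat \<Rightarrow> real \<Rightarrow> real" where
  "trig s k t = (if k = 0 then 1 else sqrt 2) * (if s then sin (pi * real k * t) else cos (pi * real k * t))"

lemma set_integrable_continuous_Ioo:
  fixes f :: "real \<Rightarrow> real"
  assumes "continuous_on UNIV f"
  shows "set_integrable lborel {a<..<b} f"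
proof (rule set_integrable_subset)
  show "set_integrable lborel {a..b} f"
    by (rule borel_integrable_atLeastAtMost') (rule continuous_on_subset[OF assms], auto)
qed auto

lemma integral_cos_pi:
  "(\<integral>t\<in>{0<..<1}. cos (pi * of_int n * t) \<partial>lborel) = (if n = 0 then 1 else 0::real)"
proof (cases "n = 0")
  case True
  thus ?thesis by (simp add: set_lebesgue_integral_def)
next
  case False
  define F where "F t = sin (pi * of_int n * t) / (pi * of_int n)" for t
  have "(LBINT t=ereal 0..ereal 1. cos (pi * of_int n * t)) = F 1 - F 0"
  proof (rule interval_integral_FTC_finite)
    fix t
    have "(F has_real_derivative cos (pi * of_int n * t)) (at t)"
      unfolding F_def using False by (auto intro!: derivative_eq_intros)
    thus "(F has_vector_derivative cos (pi * of_int n * t)) (at t within {min 0 1..max 0 1})"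
      by (simp add: has_real_derivative_iff_has_vector_derivative has_vector_derivative_at_within)
  qed (auto intro!: continuous_intros)
  also have "\<dots> = 0" by (simp add: F_def sin_times_pi_eq_0 mult.commute[of pi])
  also have "(LBINT t=ereal 0..ereal 1. cos (pi * of_int n * t)) = (\<integral>t\<in>{0<..<1}. cos (pi * of_int n * t) \<partial>lborel)"
    using interval_integral_Ioo[of "ereal 0" "ereal 1" "\<lambda>t. cos (pi * of_int n * t)"] by simp
  finally show ?thesis using False by simp
qed

lemma continuous_on_trig [continuous_intros]: "continuous_on S (trig s k)"
  unfolding trig_def[abs_def] by (cases s) (auto intro!: continuous_intros)

lemma integral_trig_mult:
  assumes "s \<Longrightarrow> k \<noteq> 0"
  shows "(\<integral>t\<in>{0<..<1}. trig s k t * trig s m t \<partial>lborel) = (if k = m then 1 else 0)"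
proof -
  define sg :: real where "sg = (if s then - 1 else 1)"
  \<comment> \<open>\<open>C\<close> contains the 1/2 of the product-to-sum formula. If k = m > 0,
    then \<open>C\<close> is 1 and only the difference frequency vanishes; if k = m = 0, both
    frequencies vanish and each term contributes 1/2.\<close>
  define C :: real where "C = (if k = 0 then 1 else sqrt 2) * (if m = 0 then 1 else sqrt 2) / 2"
  have eq: "trig s k t * trig s m t = 
    C * cos (pi * of_int (int k - int m) * t) + sg * C * cos (pi * of_int (int k + int m) * t)" for t
  proof -
    have *: "pi * of_int (int k - int m) * t = pi * real k * t - pi * real m * t" 
         "pi * of_int (int k + int m) * t = pi * real k * t + pi * real m * t"
      by (simp_all add: algebra_simps)
    show ?thesis unfolding * cos_diff cos_add trig_def C_def sg_def by (simp add: field_simps)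
  qed
  have int: "set_integrable lborel {0<..<1} (\<lambda>t. D * cos (pi * of_int n * t))" for D n
    by (rule set_integrable_continuous_Ioo) (intro continuous_intros)
  have "(\<integral>t\<in>{0<..<1}. trig s k t * trig s m t \<partial>lborel) = 
     C * (if int k - int m = 0 then 1 else 0) + sg * C * (if int k + int m = 0 then 1 else 0)"
    unfolding eq by (subst set_integral_add(2)[OF int int]) (simp only: set_integral_mult_right integral_cos_pi)
  thus ?thesis using assms by (auto simp: C_def sg_def)
qed

text \<open>\<open>S\<close> is the set of coordinates that carry a sine. \<open>S = {}\<close>
  gives the Neumann eigenfunctions of the cube, and \<open>S = {i}\<close> gives their partial
  derivatives in direction \<open>i\<close>, up to the factor \<open>- pi * k i\<close>.\<close>

definition eigfun :: "'n::finite set \<Rightarrow> ('n \<Rightarrow> nat) \<Rightarrow> real^'n \<Rightarrow> real" where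
  "eigfun S k x = (\<Prod>j\<in>UNIV. trig (j \<in> S) (k j) (x $ j))"

lemma eigfun_measurable [measurable]: "eigfun S k \<in> borel_measurable cube"
proof (rule measurable_cube, rule borel_measurable_continuous_onI)
  have "continuous_on UNIV (\<lambda>x::real^'a. trig (j \<in> S) (k j) (x $ j))" for j
    by (rule continuous_on_compose2[OF continuous_on_trig[of UNIV]]) (auto intro!: continuous_intros)
  thus "continuous_on UNIV (eigfun S k)"
    unfolding eigfun_def[abs_def] by (intro continuous_intros)
qed

lemma eigfun_square_le: "(eigfun S k x)\<^sup>2 \<le> 2 ^ nzcount k"
proof -
  have "(eigfun S k x)\<^sup>2 = (\<Prod>j\<in>UNIV. (trig (j \<in> S) (k j) (x $ j))\<^sup>2)"
    by (simp add: eigfun_def prod_power_distrib)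
  also have "\<dots> \<le> (\<Prod>j\<in>UNIV. if k j \<noteq> 0 then 2 else 1)"
  proof (intro prod_mono conjI)
    fix j
    have "(sin z)\<^sup>2 \<le> 1" "(cos z)\<^sup>2 \<le> 1" for z :: real by (simp_all add: abs_square_le_1)
    thus "(trig (j \<in> S) (k j) (x $ j))\<^sup>2 \<le> (if k j \<noteq> 0 then 2 else 1)"
      by (simp add: trig_def power_mult_distrib)
  qed auto
  also have "\<dots> = 2 ^ nzcount k" by (simp add: nzcount_def prod.If_cases)
  finally show ?thesis .
qed

lemma eigfun_square_integrable: "integrable cube (\<lambda>x. (eigfun S k x)\<^sup>2)"
  by (rule integrable_cube_bounded[of _ "2 ^ nzcount k"]) (use eigfun_square_le in auto)

lemma orthonormal_eigfun:
  fixes S :: "'n::finite set"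
  shows "orthonormal_on cube {k. \<forall>i\<in>S. k i \<noteq> 0} (eigfun S)"
  unfolding orthonormal_on_def
proof (intro conjI ballI eigfun_measurable eigfun_square_integrable)
  fix k m :: "'n \<Rightarrow> nat"
  assume km: "k \<in> {k. \<forall>i\<in>S. k i \<noteq> 0}" "m \<in> {k. \<forall>i\<in>S. k i \<noteq> 0}"
  have "(\<integral>x. eigfun S k x * eigfun S m x \<partial>cube) = 
     (\<integral>x. (\<Prod>j\<in>UNIV. trig (j \<in> S) (k j) (x $ j) * trig (j \<in> S) (m j) (x $ j)) \<partial>cube)"
    by (simp add: eigfun_def prod.distrib)
  also have "\<dots> = (\<Prod>j\<in>UNIV. \<integral>t\<in>{0<..<1}. trig (j \<in> S) (k j) t * trig (j \<in> S) (m j) t \<partial>lborel)"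
    by (intro integral_cube_prod_components set_integrable_continuous_Ioo continuous_intros)
  also have "\<dots> = (\<Prod>j\<in>UNIV. if k j = m j then 1 else 0)"
    using km by (intro prod.cong refl integral_trig_mult) auto
  also have "\<dots> = (if k = m then 1 else 0)"
    by (auto simp: fun_eq_iff prod_zero_iff)
  finally show "(\<integral>x. eigfun S k x * eigfun S m x \<partial>cube) = (if k = m then 1 else 0)" .
qed


section \<open>Completeness of the cosine system\<close>

inductive_set cos_span :: "(real^'n::finite \<Rightarrow> real) set" where
  monom: "(\<lambda>x. c * (\<Prod>j\<in>UNIV. cos (pi * real (k j) * x $ j))) \<in> cos_span"
| add: "f \<in> cos_span \<Longrightarrow> g \<in> cos_span \<Longrightarrow> (\<lambda>x. f x + g x) \<in> cos_span"

lemma cos_span_const: "(\<lambda>x. c) \<in> cos_span"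
  using cos_span.monom[of c "\<lambda>_. 0"] by simp

lemma cos_span_scale:
  assumes "f \<in> cos_span"
  shows "(\<lambda>x. c * f x) \<in> cos_span"
  using assms
proof induction
  case (monom b k)
  show ?case using cos_span.monom[of "c * b" k] by (simp add: mult.assoc)
next
  case (add f g)
  thus ?case using cos_span.add[OF add.IH] by (simp add: distrib_left)
qed

text \<open>The product-to-sum formula moves the frequency in coordinate \<open>i\<close> by one up
  and one down. Frequency 0 is separate because it can only move up.\<close>

lemma cos_span_cos_mult:
  fixes f :: "real^'n::finite \<Rightarrow> real"
  assumes "f \<in> cos_span"
  shows "(\<lambda>x. cos (pi * x $ i) * f x) \<in> cos_span"
  using assms
proof induction
  case (monom c k)
  let ?p = "\<lambda>(k::'n \<Rightarrow> nat) (x::real^'n). \<Prod>j\<in>UNIV. cos (pi * real (k j) * x $ j)"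
  have split: "?p (k(i := m)) x = cos (pi * real m * x $ i) * (\<Prod>j\<in>UNIV - {i}. cos (pi * real (k j) * x $ j))" for m x
  proof -
    have "?p (k(i := m)) x = cos (pi * real ((k(i := m)) i) * x $ i) * (\<Prod>j\<in>UNIV - {i}. cos (pi * real ((k(i := m)) j) * x $ j))"
      by (rule prod.remove) auto
    also have "(\<Prod>j\<in>UNIV - {i}. cos (pi * real ((k(i := m)) j) * x $ j)) = (\<Prod>j\<in>UNIV - {i}. cos (pi * real (k j) * x $ j))"
      by (intro prod.cong) auto
    finally show ?thesis by simp
  qed
  have split0: "?p k x = cos (pi * real (k i) * x $ i) * (\<Prod>j\<in>UNIV - {i}. cos (pi * real (k j) * x $ j))" for x
    using split[of "k i" x] by simp
  show ?case
  proof (cases "k i")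
    case 0
    have "(\<lambda>x. cos (pi * x $ i) * (c * ?p k x)) = (\<lambda>x. c * ?p (k(i := 1)) x)"
      unfolding split split0 0 by (simp add: fun_eq_iff)
    thus ?thesis using cos_span.monom[of c "k(i := 1)"] by simp
  next
    case (Suc m)
    have *: "cos (pi * t) * cos (pi * real (Suc m) * t) = (cos (pi * real m * t) + cos (pi * real (Suc (Suc m)) * t)) / 2" for t
    proof -
      have "pi * real m * t = pi * real (Suc m) * t - pi * t" 
           "pi * real (Suc (Suc m)) * t = pi * real (Suc m) * t + pi * t" by (simp_all add: algebra_simps)
      thus ?thesis by (simp only: cos_diff cos_add) simp
    qed
    have "cos (pi * x $ i) * (c * ?p k x) = c / 2 * ?p (k(i := m)) x + c / 2 * ?p (k(i := Suc (Suc m))) x" for x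
    proof -
      have "cos (pi * x $ i) * (c * ?p k x) = 
         c * (cos (pi * x $ i) * cos (pi * real (Suc m) * x $ i)) * (\<Prod>j\<in>UNIV - {i}. cos (pi * real (k j) * x $ j))"
        unfolding split0 Suc by simp
      thus ?thesis unfolding * split by (simp add: field_simps)
    qed
    thus ?thesis using cos_span.add[OF cos_span.monom[of "c / 2" "k(i := m)"] cos_span.monom[of "c / 2" "k(i := Suc (Suc m))"]]
      by simp
  qed
next
  case (add f g)
  thus ?case using cos_span.add[OF add.IH] by (simp add: distrib_left)
qed

lemma cos_span_continuous: "f \<in> cos_span \<Longrightarrow> continuous_on S f"
  by (induction rule: cos_span.induct) (auto intro!: continuous_intros)

text \<open>Merges repeated frequencies into one coefficient each, the form to which
  \<open>integral_square_residual\<close> applies.\<close>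

lemma cos_span_expansion:
  fixes f :: "real^'n::finite \<Rightarrow> real"
  assumes "f \<in> cos_span"
  shows "\<exists>F c. finite F \<and> f = (\<lambda>x. \<Sum>k\<in>F. c k * eigfun {} k x)"
  using assms
proof induction
  case (monom b k)
  define N where "N = (\<Prod>j\<in>UNIV. if k j = 0 then 1 else sqrt 2)"
  have "N \<noteq> 0" by (simp add: N_def)
  moreover have "eigfun {} k x = N * (\<Prod>j\<in>UNIV. cos (pi * real (k j) * x $ j))" for x
    by (simp add: eigfun_def trig_def N_def prod.distrib)
  ultimately show ?case by (intro exI[of _ "{k}"] exI[of _ "\<lambda>_. b / N"]) auto
next
  case (add f g)
  then obtain F c F' c' where *: "finite F" "f = (\<lambda>x. \<Sum>k\<in>F. c k * eigfun {} k x)"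
     "finite F'" "g = (\<lambda>x. \<Sum>k\<in>F'. c' k * eigfun {} k x)" by blast
  define a where "a k = (if k \<in> F then c k else 0) + (if k \<in> F' then c' k else 0)" for k
  have "f x + g x = (\<Sum>k\<in>F \<union> F'. a k * eigfun {} k x)" for x
  proof -
    have "f x = (\<Sum>k\<in>F \<union> F'. (if k \<in> F then c k else 0) * eigfun {} k x)"
      unfolding *(2) using * by (intro sum.mono_neutral_cong_left) auto
    moreover have "g x = (\<Sum>k\<in>F \<union> F'. (if k \<in> F' then c' k else 0) * eigfun {} k x)"
      unfolding *(4) using * by (intro sum.mono_neutral_cong_left) auto
    ultimately show ?thesis by (simp add: a_def distrib_right sum.distrib)
  qed
  thus ?case using * by (intro exI[of _ "F \<union> F'"] exI[of _ a]) auto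
qed

text \<open>Stone--Weierstrass is applied to the multipliers of the span of the cosine products: they form
  an algebra for trivial reasons, and the single cosines belong to it by the addition theorem.\<close>

lemma cos_span_dense:
  fixes f :: "real^'n::finite \<Rightarrow> real"
  assumes f: "continuous_on UNIV f" and e: "e > 0"
  shows "\<exists>p\<in>cos_span. \<forall>x\<in>cbox 0 1. \<bar>f x - p x\<bar> < e"
proof -
  define R where "R = {g :: real^'n \<Rightarrow> real. continuous_on UNIV g \<and> (\<forall>f\<in>cos_span. (\<lambda>x. g x * f x) \<in> cos_span)}"
  interpret function_ring_on R "cbox 0 1"
  proof
    fix f g assume f: "f \<in> R" and g: "g \<in> R"
    show "continuous_on (cbox 0 1) f" using f by (auto simp: R_def intro: continuous_on_subset)
    have "(\<lambda>x. (f x + g x) * h x) \<in> cos_span" if "h \<in> cos_span" for h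
      using f g that by (simp add: R_def distrib_right cos_span.add)
    thus "(\<lambda>x. f x + g x) \<in> R" using f g by (auto simp: R_def intro!: continuous_intros)
    have "(\<lambda>x. (f x * g x) * h x) \<in> cos_span" if "h \<in> cos_span" for h
      using f g that by (simp add: R_def mult.assoc)
    thus "(\<lambda>x. f x * g x) \<in> R" using f g by (auto simp: R_def intro!: continuous_intros)
  next
    fix c show "(\<lambda>_. c) \<in> R" by (auto simp: R_def cos_span_scale)
  next
    fix x y :: "real^'n" assume xy: "x \<in> cbox 0 1" "y \<in> cbox 0 1" "x \<noteq> y"
    then obtain i where i: "x $ i \<noteq> y $ i" by (auto simp: vec_eq_iff)
    have "0 \<le> x $ i" "x $ i \<le> 1" "0 \<le> y $ i" "y $ i \<le> 1" using xy by (auto simp: mem_box_cart)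
    \<comment> \<open>Cosine is injective on [0, pi], so the cosines of frequency 1 already separate
      the points of the closed cube.\<close>
    hence "cos (pi * x $ i) \<noteq> cos (pi * y $ i)"
      using i cos_inj_pi[of "pi * x $ i" "pi * y $ i"] by auto
    moreover have "(\<lambda>x. cos (pi * x $ i)) \<in> R"
      by (auto simp: R_def cos_span_cos_mult intro!: continuous_intros)
    ultimately show "\<exists>f\<in>R. f x \<noteq> f y" by (rule bexI)
  qed auto
  obtain p where p: "p \<in> R" "\<forall>x\<in>cbox 0 1. \<bar>f x - p x\<bar> < e"
    using Stone_Weierstrass_basic[OF continuous_on_subset[OF f] e] by auto
  from p(1) have "\<forall>f\<in>cos_span. (\<lambda>x. p x * f x) \<in> cos_span" by (simp add: R_def)
  \<comment> \<open>Applying the multiplier to the constant function 1 shows that it lies in the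
    span itself.\<close>
  from bspec[OF this cos_span_const[of 1]] have "p \<in> cos_span" by simp
  with p(2) show ?thesis by (intro bexI[of _ p])
qed

section \<open>Approximation in L^2 by bounded and by continuous functions\<close>

lemma L2_truncation:
  fixes u :: "'a \<Rightarrow> real"
  assumes [measurable]: "u \<in> borel_measurable M" and u2: "integrable M (\<lambda>x. (u x)\<^sup>2)" and e: "e > 0"
  shows "\<exists>n::nat. (\<integral>x. (u x - max (- real n) (min (real n) (u x)))\<^sup>2 \<partial>M) < e"
proof -
  have "(\<lambda>n. \<integral>x. (u x - max (- real n) (min (real n) (u x)))\<^sup>2 \<partial>M) \<longlonglongrightarrow> (\<integral>x. 0 \<partial>M)"
  proof (rule integral_dominated_convergence[where w="\<lambda>x. (u x)\<^sup>2"])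
    show "AE x in M. (\<lambda>n. (u x - max (- real n) (min (real n) (u x)))\<^sup>2) \<longlonglongrightarrow> 0"
    proof (rule AE_I2, rule tendsto_eventually)
      fix x
      obtain N where "\<bar>u x\<bar> \<le> real N" using real_arch_simple by blast
      thus "\<forall>\<^sub>F n in sequentially. (u x - max (- real n) (min (real n) (u x)))\<^sup>2 = 0"
        by (intro eventually_sequentiallyI[of N]) (auto simp: max_def min_def)
    qed
    show "AE x in M. norm ((u x - max (- real n) (min (real n) (u x)))\<^sup>2) \<le> (u x)\<^sup>2" for n
    proof (rule AE_I2)
      fix x
      have "\<bar>u x - max (- real n) (min (real n) (u x))\<bar> \<le> \<bar>u x\<bar>" by (auto simp: max_def min_def)
      thus "norm ((u x - max (- real n) (min (real n) (u x)))\<^sup>2) \<le> (u x)\<^sup>2" 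
        by (simp add: abs_le_square_iff)
    qed
  qed (use u2 in auto)
  hence "\<forall>\<^sub>F n in sequentially. (\<integral>x. (u x - max (- real n) (min (real n) (u x)))\<^sup>2 \<partial>M) < e"
    using e by (intro order_tendstoD) auto
  thus ?thesis by (auto simp: eventually_sequentially)
qed

text \<open>A Lebesgue measurable function is an almost everywhere limit of continuous ones.
  Clipping these at \<open>B\<close> preserves continuity and the limit, and supplies the constant
  majorant \<open>(2 * B)\<^sup>2\<close> for dominated convergence.\<close>

lemma L2_continuous_approx:
  fixes u :: "real^'n::finite \<Rightarrow> real"
  assumes [measurable]: "u \<in> borel_measurable cube" and B: "\<And>x. \<bar>u x\<bar> \<le> B" and e: "e > 0"
  shows "\<exists>f. continuous_on UNIV f \<and> integrable cube (\<lambda>x. (u x - f x)\<^sup>2) \<and> (\<integral>x. (u x - f x)\<^sup>2 \<partial>cube) < e"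
proof -
  define U where "U x = indicator (box 0 1) x * u x" for x
  have "U \<in> borel_measurable lborel" using assms(1) unfolding measurable_cube_iff U_def[abs_def] .
  hence "U \<in> borel_measurable lebesgue" by (rule measurable_completion)
  hence "U measurable_on UNIV" by (rule lebesgue_measurable_imp_measurable_on) auto
  then obtain N g where N: "negligible N" and g: "\<And>n. continuous_on UNIV (g n)"
     and lim: "\<And>x. x \<notin> N \<Longrightarrow> (\<lambda>n. g n x) \<longlonglongrightarrow> U x"
    unfolding measurable_on_def by auto
  define h where "h n x = max (- B) (min B (g n x))" for n :: nat and x
  have h: "continuous_on UNIV (h n)" for n
    unfolding h_def[abs_def] by (intro continuous_intros g)
  have [measurable]: "h n \<in> borel_measurable cube" for n
    by (intro measurable_cube borel_measurable_continuous_onI h)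
  have B0: "0 \<le> B" using B[of 0] by linarith
  have bd: "(u x - h n x)\<^sup>2 \<le> (2 * B)\<^sup>2" for n x
  proof -
    have "\<bar>u x - h n x\<bar> \<le> \<bar>2 * B\<bar>" using B[of x] B0 by (auto simp: h_def max_def min_def)
    thus ?thesis by (simp only: abs_le_square_iff)
  qed
  have ae: "AE x in cube. (\<lambda>n. g n x) \<longlonglongrightarrow> u x"
  proof -
    have "AE x in lebesgue. x \<notin> N" using N by (simp add: negligible_iff_null_sets AE_not_in)
    hence "AE x in lborel. x \<notin> N" by (simp add: AE_completion_iff)
    hence "AE x in lborel. x \<in> box 0 1 \<longrightarrow> (\<lambda>n. g n x) \<longlonglongrightarrow> u x"
      by eventually_elim (use lim in \<open>force simp: U_def\<close>)
    thus ?thesis unfolding cube_def by (subst AE_restrict_space_iff) auto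
  qed
  have "(\<lambda>n. \<integral>x. (u x - h n x)\<^sup>2 \<partial>cube) \<longlonglongrightarrow> (\<integral>x. 0 \<partial>(cube :: (real^'n) measure))"
  proof (rule integral_dominated_convergence[where w="\<lambda>x. (2 * B)\<^sup>2"])
    show "AE x in cube. (\<lambda>n. (u x - h n x)\<^sup>2) \<longlonglongrightarrow> 0"
      using ae
    proof eventually_elim
      case (elim x)
      have "(\<lambda>n. (u x - h n x)\<^sup>2) \<longlonglongrightarrow> (u x - max (- B) (min B (u x)))\<^sup>2"
        unfolding h_def by (intro tendsto_intros elim)
      also have "max (- B) (min B (u x)) = u x" using B[of x] by auto
      finally show ?case by simp
    qed
  qed (use bd in \<open>auto intro!: integrable_cube_bounded\<close>)
  hence "\<forall>\<^sub>F n in sequentially. (\<integral>x. (u x - h n x)\<^sup>2 \<partial>cube) < e"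
    using e by (intro order_tendstoD) auto
  then obtain n where "(\<integral>x. (u x - h n x)\<^sup>2 \<partial>cube) < e" by (auto simp: eventually_sequentially)
  moreover have "integrable cube (\<lambda>x. (u x - h n x)\<^sup>2)"
    by (rule integrable_cube_bounded[of _ "(2 * B)\<^sup>2"]) (use bd in auto)
  ultimately show ?thesis using h by blast
qed

lemma continuous_L2_cube:
  fixes f :: "real^'n::finite \<Rightarrow> real"
  assumes "continuous_on UNIV f"
  shows "f \<in> borel_measurable cube" "integrable cube (\<lambda>x. (f x)\<^sup>2)"
proof -
  show *: "f \<in> borel_measurable cube"
    by (intro measurable_cube borel_measurable_continuous_onI assms)
  have "compact (f ` cbox 0 1)"
    by (rule compact_continuous_image) (auto intro: continuous_on_subset[OF assms])
  then obtain B where B: "\<And>x. x \<in> cbox 0 1 \<Longrightarrow> \<bar>f x\<bar> \<le> B"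
    by (metis bounded_real compact_imp_bounded image_eqI)
  show "integrable cube (\<lambda>x. (f x)\<^sup>2)"
  proof (rule integrable_cube_bounded[of _ "B\<^sup>2"])
    fix x :: "real^'n" assume "x \<in> box 0 1"
    hence "\<bar>f x\<bar> \<le> B" using box_subset_cbox[of 0 "1::real^'n"] B by blast
    hence "\<bar>f x\<bar>\<^sup>2 \<le> B\<^sup>2" by (intro power_mono) auto
    thus "\<bar>(f x)\<^sup>2\<bar> \<le> B\<^sup>2" by simp
  qed (use * in measurable)
qed

text \<open>The hard half of Parseval, in epsilon form. A trigonometric polynomial p close to u in
  L^2 exists by density, and on the frequencies of p the Fourier sum of u approximates at least as
  well as p.\<close>

lemma eigfun_complete:
  fixes u :: "real^'n::finite \<Rightarrow> real"
  assumes u [measurable]: "u \<in> borel_measurable cube" and u2: "integrable cube (\<lambda>x. (u x)\<^sup>2)" and e: "e > 0"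
  shows "\<exists>F. finite F \<and> (\<integral>x. (u x)\<^sup>2 \<partial>cube) < (\<Sum>k\<in>F. (\<integral>x. u x * eigfun {} k x \<partial>cube)\<^sup>2) + e"
proof -
  \<comment> \<open>Budget: the two errors below e/16 and at most e/16 double to less than e/4 in
    total; then 2 * e/8 + 2 * e/4 is still below e.\<close>
  from L2_truncation[OF u u2, of "e / 8"] e obtain n :: nat
    where n: "(\<integral>x. (u x - max (- real n) (min (real n) (u x)))\<^sup>2 \<partial>cube) < e / 8" by auto
  define w where "w x = max (- real n) (min (real n) (u x))" for x
  have w [measurable]: "w \<in> borel_measurable cube" unfolding w_def[abs_def] by measurable
  have wB: "\<bar>w x\<bar> \<le> real n" for x by (auto simp: w_def)
  have w2: "integrable cube (\<lambda>x. (w x)\<^sup>2)"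
    by (rule integrable_cube_bounded[of _ "(real n)\<^sup>2"]) (use wB in \<open>auto simp: abs_le_square_iff[symmetric]\<close>)
  from L2_continuous_approx[OF w wB, of "e / 16"] e obtain f
    where f: "continuous_on UNIV f" "integrable cube (\<lambda>x. (w x - f x)\<^sup>2)" "(\<integral>x. (w x - f x)\<^sup>2 \<partial>cube) < e / 16"
    by auto
  from cos_span_dense[OF f(1), of "sqrt (e / 16)"] e obtain p
    where p: "p \<in> cos_span" "\<And>x. x \<in> cbox 0 1 \<Longrightarrow> \<bar>f x - p x\<bar> < sqrt (e / 16)" by auto
  note [measurable] = continuous_L2_cube(1)[OF f(1)] continuous_L2_cube(1)[OF cos_span_continuous[OF p(1)]]
  note p2 = continuous_L2_cube(2)[OF cos_span_continuous[OF p(1)]]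
  note f2 = continuous_L2_cube(2)[OF f(1)]
  have ifp: "integrable cube (\<lambda>x. (f x - p x)\<^sup>2)" by (rule integrable_add_L2) (use f2 p2 in measurable)
  have "(\<integral>x. (f x - p x)\<^sup>2 \<partial>cube) \<le> (\<integral>x. e / 16 \<partial>(cube :: (real^'n) measure))"
  proof (rule integral_mono[OF ifp])
    show "integrable (cube :: (real^'n) measure) (\<lambda>x. e / 16)" 
      by (rule integrable_cube_bounded[of _ "e / 16"]) (use e in auto)
    fix x :: "real^'n" assume "x \<in> space cube"
    hence "\<bar>f x - p x\<bar> \<le> sqrt (e / 16)" using box_subset_cbox[of 0 "1::real^'n"] p(2)[of x] by force
    hence "\<bar>f x - p x\<bar>\<^sup>2 \<le> (sqrt (e / 16))\<^sup>2" by (intro power_mono) auto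
    thus "(f x - p x)\<^sup>2 \<le> e / 16" using e by simp
  qed
  also have "\<dots> = e / 16" by (simp add: measure_def prob_space_cube[simplified])
  finally have fp: "(\<integral>x. (f x - p x)\<^sup>2 \<partial>cube) \<le> e / 16" .
  have "(\<integral>x. (w x - p x)\<^sup>2 \<partial>cube) \<le> 2 * (\<integral>x. (w x - f x)\<^sup>2 \<partial>cube) + 2 * (\<integral>x. (f x - p x)\<^sup>2 \<partial>cube)"
    by (intro integral_square_triangle f(2) ifp) measurable
  with fp f(3) have wp: "(\<integral>x. (w x - p x)\<^sup>2 \<partial>cube) < e / 4" by linarith
  have "(\<integral>x. (u x - p x)\<^sup>2 \<partial>cube) \<le> 2 * (\<integral>x. (u x - w x)\<^sup>2 \<partial>cube) + 2 * (\<integral>x. (w x - p x)\<^sup>2 \<partial>cube)"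
    by (intro integral_square_triangle integrable_add_L2 u2 w2 p2) measurable
  also have "\<dots> < e" using wp n e unfolding w_def[symmetric] by linarith
  finally have up: "(\<integral>x. (u x - p x)\<^sup>2 \<partial>cube) < e" .
  obtain F c where F: "finite F" "p = (\<lambda>x. \<Sum>k\<in>F. c k * eigfun {} k x)"
    using cos_span_expansion[OF p(1)] by blast
  have "(\<integral>x. (u x)\<^sup>2 \<partial>cube) - (\<Sum>k\<in>F. (\<integral>x. u x * eigfun {} k x \<partial>cube)\<^sup>2) 
    \<le> (\<integral>x. (u x)\<^sup>2 \<partial>cube) - (\<Sum>k\<in>F. (\<integral>x. u x * eigfun {} k x \<partial>cube)\<^sup>2)
      + (\<Sum>k\<in>F. (c k - (\<integral>x. u x * eigfun {} k x \<partial>cube))\<^sup>2)" by (simp add: sum_nonneg)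
  also have "\<dots> = (\<integral>x. (u x - p x)\<^sup>2 \<partial>cube)"
    unfolding F(2) by (rule integral_square_residual(1)[OF orthonormal_eigfun[of "{}"] F(1) _ u u2, symmetric]) auto
  finally show ?thesis using up F(1) by (intro exI[of _ F]) auto
qed


section \<open>Fourier coefficients of the weak gradient\<close>

lemma trig_smooth_alg: "trig s k \<in> smooth_alg"
  using smooth_alg.mult[OF smooth_alg.const smooth_alg.sin] smooth_alg.mult[OF smooth_alg.const smooth_alg.cos]
  by (cases s) (simp_all add: trig_def[abs_def])

lemma sin_trig_has_derivative:
  "(trig True k has_real_derivative pi * real k * trig False k t) (at t)"
  unfolding trig_def[abs_def] by (auto intro!: derivative_eq_intros)

lemma norm_const_le: "(if k = 0 then 1 else sqrt 2) * b \<le> 2 * b" if "0 \<le> (b::real)" for k :: nat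
proof -
  have "sqrt 2 \<le> sqrt 4" by (intro real_sqrt_le_mono) simp
  hence "sqrt 2 \<le> (2::real)" by simp
  thus ?thesis using that by (intro mult_right_mono) auto
qed

lemma abs_trig_le: "\<bar>trig s k t\<bar> \<le> 2"
proof -
  have "\<bar>trig s k t\<bar> = (if k = 0 then 1 else sqrt 2) * \<bar>if s then sin (pi * real k * t) else cos (pi * real k * t)\<bar>"
    by (simp add: trig_def abs_mult)
  also have "\<dots> \<le> 2 * \<bar>if s then sin (pi * real k * t) else cos (pi * real k * t)\<bar>"
    by (rule norm_const_le) simp
  also have "\<dots> \<le> 2 * 1" by (intro mult_left_mono) auto
  finally show ?thesis by simp
qed

text \<open>Linear vanishing at both ends is the hypothesis of \<open>cutoff'_bound\<close>. The end
  t = 1 reduces to t = 0 because sin(k pi - y) equals sin y up to sign.\<close>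

lemma abs_sin_trig_le:
  "\<bar>trig True k t\<bar> \<le> 2 * (pi * real k) * \<bar>t\<bar>" "\<bar>trig True k t\<bar> \<le> 2 * (pi * real k) * \<bar>1 - t\<bar>"
proof -
  have eq: "\<bar>trig True k t\<bar> = (if k = 0 then 1 else sqrt 2) * \<bar>sin (pi * real k * t)\<bar>" for t
    by (simp add: trig_def abs_mult)
  have le: "\<bar>trig True k t\<bar> \<le> 2 * (pi * real k) * \<bar>t\<bar>" for t
  proof -
    have "\<bar>trig True k t\<bar> \<le> 2 * \<bar>sin (pi * real k * t)\<bar>"
      unfolding eq by (rule norm_const_le) simp
    also have "\<bar>sin (pi * real k * t)\<bar> \<le> \<bar>pi * real k * t\<bar>" by (rule abs_sin_x_le_abs_x)
    finally show ?thesis by (simp add: abs_mult)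
  qed
  show "\<bar>trig True k t\<bar> \<le> 2 * (pi * real k) * \<bar>t\<bar>" by (rule le)
  have "sin (pi * real k * (1 - t)) = sin (real k * pi - pi * real k * t)" by (simp add: algebra_simps)
  hence "\<bar>sin (pi * real k * (1 - t))\<bar> = \<bar>sin (pi * real k * t)\<bar>"
    by (simp add: sin_diff abs_mult)
  hence "\<bar>trig True k (1 - t)\<bar> = \<bar>trig True k t\<bar>" unfolding eq by simp
  thus "\<bar>trig True k t\<bar> \<le> 2 * (pi * real k) * \<bar>1 - t\<bar>" using le[of "1 - t"] by simp
qed

lemma continuous_on_flat: "continuous_on UNIV (flat n)"
  using flat_has_derivative DERIV_isCont by (blast intro: continuous_at_imp_continuous_on)

lemma continuous_on_cutoff: "continuous_on UNIV (cutoff e)" "continuous_on UNIV (cutoff' e)"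
  unfolding cutoff_def[abs_def] cutoff'_def[abs_def]
  by (intro continuous_intros continuous_on_compose2[OF continuous_on_flat]; simp)+

lemma measurable_cube_prod_components:
  fixes a :: "'n::finite \<Rightarrow> real \<Rightarrow> real"
  assumes "\<And>j. j \<in> S \<Longrightarrow> continuous_on UNIV (a j)"
  shows "(\<lambda>x::real^'n. \<Prod>j\<in>S. a j (x $ j)) \<in> borel_measurable cube"
proof (intro measurable_cube borel_measurable_continuous_onI continuous_on_prod)
  fix j assume "j \<in> S"
  show "continuous_on UNIV (\<lambda>x::real^'n. a j (x $ j))"
    by (rule continuous_on_compose2[OF assms[OF \<open>j \<in> S\<close>]]) (auto intro!: continuous_intros)
qed

text \<open>The weak derivative is tested with \<open>eigfun {i} k\<close>, cut off in every
  coordinate, and the cutoff width is sent to 0. Both integrands are bounded by a constant times the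
  integrable functions |u| and |g_i|, since the derivative of the cutoff occurs only next to the
  sine factor.\<close>

lemma weak_gradient_coeff:
  fixes u :: "real^'n::finite \<Rightarrow> real"
  assumes W: "W11_grad (box 0 1) u g" and i: "k i \<noteq> 0"
  shows "(\<integral>x. g x $ i * eigfun {i} k x \<partial>cube) = - (pi * real (k i)) * (\<integral>x. u x * eigfun {} k x \<partial>cube)"
proof -
  have u: "integrable cube u" and g: "integrable cube (\<lambda>x. g x $ i)"
    using W by (auto simp: W11_grad_def integrable_cube_iff)
  note [measurable] = borel_measurable_integrable[OF u] borel_measurable_integrable[OF g]
  define \<epsilon> where "\<epsilon> n = inverse (real (Suc n))" for n
  have \<epsilon>: "\<epsilon> n > 0" for n by (simp add: \<epsilon>_def)
  have \<epsilon>_lim: "filterlim \<epsilon> (at_right 0) sequentially"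
    unfolding \<epsilon>_def[abs_def] filterlim_at using LIMSEQ_inverse_real_of_nat by auto
  define a where "a n j t = trig (j \<in> {i}) (k j) t * cutoff (\<epsilon> n) t" for n j t
  define D where "D n t = pi * real (k i) * trig False (k i) t * cutoff (\<epsilon> n) t + trig True (k i) t * cutoff' (\<epsilon> n) t" for n t
  define \<phi> where "\<phi> n x = (\<Prod>j\<in>UNIV. a n j (x $ j))" for n and x :: "real^'n"
  have test: "test_fun (box 0 1) (\<phi> n)" for n
    unfolding \<phi>_def[abs_def] a_def by (rule test_fun_cutoff[OF trig_smooth_alg \<epsilon>])
  have a_deriv: "\<exists>d. \<forall>t. (a n j has_real_derivative d t) (at t)" for n j
    using smooth_alg_derivative[OF smooth_alg.mult[OF trig_smooth_alg cutoff_smooth_alg]]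
    unfolding a_def[abs_def] by blast
  then obtain a' where a': "\<And>n j t. (a n j has_real_derivative a' n j t) (at t)" by metis
  have a'_i: "a' n i t = D n t" for n t
  proof (rule DERIV_unique[OF a'])
    show "(a n i has_real_derivative D n t) (at t)"
      unfolding a_def[abs_def] D_def
      using DERIV_mult[OF sin_trig_has_derivative[of "k i" t] cutoff_has_derivative[of "\<epsilon> n" t]]
      by (simp add: algebra_simps)
  qed
  have part: "partial i (\<phi> n) x = D n (x $ i) * (\<Prod>j\<in>UNIV - {i}. a n j (x $ j))" for n x
    unfolding \<phi>_def[abs_def] a'_i[symmetric] by (rule partial_prod_components) (rule a')
  have weak: "(\<integral>x. u x * partial i (\<phi> n) x \<partial>cube) = - (\<integral>x. g x $ i * \<phi> n x \<partial>cube)" for n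
    using W test[of n] by (auto simp: W11_grad_def integral_cube)
  have cont: "continuous_on UNIV (a n j)" "continuous_on UNIV (D n)" for n j
    unfolding a_def[abs_def] D_def[abs_def] by (intro continuous_intros continuous_on_cutoff)+
  have D_meas: "(\<lambda>x. D n (x $ i)) \<in> borel_measurable cube" for n
    using measurable_cube_prod_components[of "{i}" "\<lambda>_. D n"] cont by simp
  have \<phi>_meas: "\<phi> n \<in> borel_measurable cube" for n
    unfolding \<phi>_def[abs_def] by (intro measurable_cube_prod_components cont)
  have part_meas: "partial i (\<phi> n) \<in> borel_measurable cube" for n
    unfolding part[abs_def] by (intro borel_measurable_times D_meas measurable_cube_prod_components cont)
  note [measurable] = \<phi>_meas part_meas
  have a_le: "\<bar>a n j t\<bar> \<le> 2" for n j t
  proof -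
    have "\<bar>a n j t\<bar> \<le> 2 * 1" unfolding a_def abs_mult
      using cutoff_bounds[of "\<epsilon> n" t] by (intro mult_mono abs_trig_le) auto
    thus ?thesis by simp
  qed
  have prod_le: "\<bar>\<Prod>j\<in>S. a n j (x $ j)\<bar> \<le> 2 ^ card S" for n S and x :: "real^'n"
  proof -
    have "\<bar>\<Prod>j\<in>S. a n j (x $ j)\<bar> = (\<Prod>j\<in>S. \<bar>a n j (x $ j)\<bar>)" by (rule abs_prod)
    also have "\<dots> \<le> (\<Prod>j\<in>S. 2)" by (rule prod_mono) (use a_le in auto)
    finally show ?thesis by simp
  qed
  \<comment> \<open>The first summand uses that a trigonometric factor is at most 2 and the cutoff
    at most 1. The second is the 6c of \<open>cutoff'_bound\<close> with the slope c = 2 pi k_i from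
    \<open>abs_sin_trig_le\<close>.\<close>
  define C where "C = pi * real (k i) * 2 + 6 * (2 * (pi * real (k i)))"
  have D_le: "\<bar>D n t\<bar> \<le> C" if t: "0 < t" "t < 1" for n t
  proof -
    have "\<bar>pi * real (k i) * trig False (k i) t * cutoff (\<epsilon> n) t\<bar> \<le> pi * real (k i) * 2 * 1"
      unfolding abs_mult using cutoff_bounds[of "\<epsilon> n" t] abs_trig_le[of False "k i" t]
      by (intro mult_mono) auto
    moreover have "\<bar>trig True (k i) t * cutoff' (\<epsilon> n) t\<bar> \<le> 6 * (2 * (pi * real (k i)))"
      using abs_sin_trig_le[of "k i" t] t by (intro cutoff'_bound \<epsilon>) auto
    ultimately show ?thesis unfolding D_def C_def by linarith
  qed
  have a_lim: "(\<lambda>n. a n j t) \<longlonglongrightarrow> trig (j \<in> {i}) (k j) t" if "0 < t" "t < 1" for j t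
    unfolding a_def using tendsto_mult[OF tendsto_const filterlim_compose[OF cutoff_tendsto(1)[OF that] \<epsilon>_lim]] by simp
  have D_lim: "(\<lambda>n. D n t) \<longlonglongrightarrow> pi * real (k i) * trig False (k i) t" if "0 < t" "t < 1" for t
    unfolding D_def
    using tendsto_add[OF tendsto_mult[OF tendsto_const filterlim_compose[OF cutoff_tendsto(1)[OF that] \<epsilon>_lim]]
        tendsto_mult[OF tendsto_const filterlim_compose[OF cutoff_tendsto(2)[OF that] \<epsilon>_lim]]] by simp
  have x01: "0 < x $ j" "x $ j < 1" if "x \<in> box 0 1" for x :: "real^'n" and j
    using that by (auto simp: mem_box_cart)
  have eig: "eigfun {} k x = trig False (k i) (x $ i) * (\<Prod>j\<in>UNIV - {i}. trig (j \<in> {i}) (k j) (x $ j))" for x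
  proof -
    have "eigfun {} k x = trig (i \<in> {}) (k i) (x $ i) * (\<Prod>j\<in>UNIV - {i}. trig (j \<in> {}) (k j) (x $ j))"
      unfolding eigfun_def by (rule prod.remove) auto
    also have "(\<Prod>j\<in>UNIV - {i}. trig (j \<in> {}) (k j) (x $ j)) = (\<Prod>j\<in>UNIV - {i}. trig (j \<in> {i}) (k j) (x $ j))"
      by (intro prod.cong) auto
    finally show ?thesis by simp
  qed
  have lim1: "(\<lambda>n. \<integral>x. u x * partial i (\<phi> n) x \<partial>cube) \<longlonglongrightarrow> (\<integral>x. u x * (pi * real (k i) * eigfun {} k x) \<partial>cube)"
  proof (rule integral_dominated_convergence[where w="\<lambda>x. \<bar>u x\<bar> * (C * 2 ^ card (UNIV - {i}))"])
    show "AE x in cube. (\<lambda>n. u x * partial i (\<phi> n) x) \<longlonglongrightarrow> u x * (pi * real (k i) * eigfun {} k x)"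
    proof (rule AE_I2)
      fix x :: "real^'n" assume x: "x \<in> space cube"
      have "(\<lambda>n. u x * (D n (x $ i) * (\<Prod>j\<in>UNIV - {i}. a n j (x $ j)))) \<longlonglongrightarrow> 
         u x * (pi * real (k i) * trig False (k i) (x $ i) * (\<Prod>j\<in>UNIV - {i}. trig (j \<in> {i}) (k j) (x $ j)))"
        using x by (intro tendsto_mult tendsto_const tendsto_prod D_lim a_lim x01) auto
      thus "(\<lambda>n. u x * partial i (\<phi> n) x) \<longlonglongrightarrow> u x * (pi * real (k i) * eigfun {} k x)"
        unfolding part eig by (simp only: mult.assoc)
    qed
    show "AE x in cube. norm (u x * partial i (\<phi> n) x) \<le> \<bar>u x\<bar> * (C * 2 ^ card (UNIV - {i}))" for n
    proof (rule AE_I2)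
      fix x :: "real^'n" assume x: "x \<in> space cube"
      have "\<bar>D n (x $ i) * (\<Prod>j\<in>UNIV - {i}. a n j (x $ j))\<bar> \<le> C * 2 ^ card (UNIV - {i})"
        unfolding abs_mult using x by (intro mult_mono D_le prod_le x01) (auto simp: C_def)
      thus "norm (u x * partial i (\<phi> n) x) \<le> \<bar>u x\<bar> * (C * 2 ^ card (UNIV - {i}))"
        unfolding part real_norm_def abs_mult[of "u x"] by (intro mult_left_mono) auto
    qed
  qed (use u in auto)
  have lim2: "(\<lambda>n. \<integral>x. g x $ i * \<phi> n x \<partial>cube) \<longlonglongrightarrow> (\<integral>x. g x $ i * eigfun {i} k x \<partial>cube)"
  proof (rule integral_dominated_convergence[where w="\<lambda>x. \<bar>g x $ i\<bar> * 2 ^ CARD('n)"])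
    show "AE x in cube. (\<lambda>n. g x $ i * \<phi> n x) \<longlonglongrightarrow> g x $ i * eigfun {i} k x"
      unfolding \<phi>_def eigfun_def
      by (intro AE_I2 tendsto_mult tendsto_const tendsto_prod a_lim x01) auto
    show "AE x in cube. norm (g x $ i * \<phi> n x) \<le> \<bar>g x $ i\<bar> * 2 ^ CARD('n)" for n
      unfolding \<phi>_def real_norm_def abs_mult[of "g _ $ i"] by (intro AE_I2 mult_left_mono prod_le) auto
  qed (use g in auto)
  have "(\<integral>x. u x * (pi * real (k i) * eigfun {} k x) \<partial>cube) = - (\<integral>x. g x $ i * eigfun {i} k x \<partial>cube)"
    by (rule LIMSEQ_unique[OF lim1]) (unfold weak, intro tendsto_minus lim2)
  moreover have "(\<integral>x. u x * (pi * real (k i) * eigfun {} k x) \<partial>cube) = pi * real (k i) * (\<integral>x. u x * eigfun {} k x \<partial>cube)"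
    by (subst integral_mult_right_zero[symmetric]) (simp add: mult_ac)
  ultimately show ?thesis by simp
qed

text \<open>The squared norm of k splits over the coordinates. For each \<open>i\<close>, the terms
  with \<open>k i = 0\<close> vanish, and the remaining ones are squared coefficients of the
  \<open>i\<close>-th gradient component in the orthonormal system
  \<open>eigfun {i}\<close>.\<close>

lemma gradient_Bessel:
  fixes u :: "real^'n::finite \<Rightarrow> real"
  assumes W: "W11_grad (box 0 1) u g" and g2: "integrable cube (\<lambda>x. (norm (g x))\<^sup>2)" and F: "finite F"
  shows "(\<Sum>k\<in>F. (pi * knorm k)\<^sup>2 * (\<integral>x. u x * eigfun {} k x \<partial>cube)\<^sup>2) \<le> (\<integral>x. (norm (g x))\<^sup>2 \<partial>cube)"
proof -
  define a where "a k = (\<integral>x. u x * eigfun {} k x \<partial>cube)" for k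
  have gm [measurable]: "(\<lambda>x. g x $ i) \<in> borel_measurable cube" for i
    using W by (auto simp: W11_grad_def integrable_cube_iff[symmetric] dest: borel_measurable_integrable)
  have norm: "(norm (g x))\<^sup>2 = (\<Sum>i\<in>UNIV. (g x $ i)\<^sup>2)" for x
    by (simp add: norm_vec_def L2_set_def sum_nonneg)
  have "(g x $ i)\<^sup>2 \<le> (norm (g x))\<^sup>2" for x i
    unfolding norm by (rule member_le_sum) auto
  hence gi2: "integrable cube (\<lambda>x. (g x $ i)\<^sup>2)" for i
    by (intro Bochner_Integration.integrable_bound[OF g2]) auto
  have "(\<Sum>k\<in>F. (pi * knorm k)\<^sup>2 * (a k)\<^sup>2) = (\<Sum>k\<in>F. \<Sum>i\<in>UNIV. (pi * real (k i) * a k)\<^sup>2)"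
    by (simp add: knorm_def power_mult_distrib sum_nonneg sum_distrib_left sum_distrib_right mult_ac)
  also have "\<dots> = (\<Sum>i\<in>UNIV. \<Sum>k\<in>F. (pi * real (k i) * a k)\<^sup>2)" by (rule sum.swap)
  also have "\<dots> \<le> (\<Sum>i\<in>UNIV. \<integral>x. (g x $ i)\<^sup>2 \<partial>cube)"
  proof (rule sum_mono)
    fix i :: 'n
    have "(\<Sum>k\<in>F. (pi * real (k i) * a k)\<^sup>2) = (\<Sum>k\<in>{k\<in>F. k i \<noteq> 0}. (\<integral>x. g x $ i * eigfun {i} k x \<partial>cube)\<^sup>2)"
      using F by (intro sum.mono_neutral_cong_right) (auto simp: weak_gradient_coeff[OF W] a_def power_mult_distrib)
    also have "\<dots> \<le> (\<integral>x. (g x $ i)\<^sup>2 \<partial>cube)"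
      by (rule Bessel_inequality[OF orthonormal_eigfun[of "{i}"]]) (use F gi2 in auto)
    finally show "(\<Sum>k\<in>F. (pi * real (k i) * a k)\<^sup>2) \<le> (\<integral>x. (g x $ i)\<^sup>2 \<partial>cube)" .
  qed
  also have "\<dots> = (\<integral>x. (norm (g x))\<^sup>2 \<partial>cube)"
    unfolding norm by (rule Bochner_Integration.integral_sum[symmetric]) (rule gi2)
  finally show ?thesis unfolding a_def .
qed


section \<open>The energy decomposition\<close>

text \<open>Scaling E by the zero T of b - A E^p reduces the integral to b^2 T times that of (1 -
  s^p)^2 over [0,1], which is the bracket; and b^2 T is the product of powers of b and A.\<close>

lemma nn_integral_truncated_power:
  fixes b A p :: real
  assumes b: "b \<ge> 0" and A: "A > 0" and p: "p > 0"
  shows "ennreal ((1 - 2 / (p + 1) + 1 / (2 * p + 1)) * b powr (2 + 1 / p) * A powr (- 1 / p))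
    \<le> (\<integral>\<^sup>+E. ennreal ((max 0 (b - A * E powr p))\<^sup>2) * indicator {0<..} E \<partial>lborel)"
proof -
  define T where "T = (b / A) powr (1 / p)"
  have T: "T \<ge> 0" by (simp add: T_def)
  have Tp: "A * T powr p = b" using A b p by (simp add: T_def powr_powr)
  have le: "A * E powr p \<le> b" if "0 \<le> E" "E \<le> T" for E
    using A p powr_mono2[of p E T] that by (subst Tp[symmetric]) (intro mult_left_mono, auto)
  have "((\<lambda>E. b\<^sup>2 * E powr 0 - (2 * b * A) * E powr p + A\<^sup>2 * E powr (2 * p)) has_integral
      b\<^sup>2 * (T powr (0 + 1) / (0 + 1)) - (2 * b * A) * (T powr (p + 1) / (p + 1)) 
      + A\<^sup>2 * (T powr (2 * p + 1) / (2 * p + 1))) {0..T}"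
    using p T by (intro has_integral_add has_integral_diff has_integral_mult_right has_integral_powr_from_0) auto
  also have "b\<^sup>2 * (T powr (0 + 1) / (0 + 1)) - (2 * b * A) * (T powr (p + 1) / (p + 1)) 
      + A\<^sup>2 * (T powr (2 * p + 1) / (2 * p + 1)) = (1 - 2 / (p + 1) + 1 / (2 * p + 1)) * (b\<^sup>2 * T)"
  proof -
    have 1: "A * T powr (p + 1) = b * T" using T Tp by (simp add: powr_add mult.assoc[symmetric])
    have "T powr (2 * p) = (T powr p)\<^sup>2" by (simp add: power2_eq_square flip: powr_add)
    hence 2: "A\<^sup>2 * T powr (2 * p + 1) = b\<^sup>2 * T" using T Tp[symmetric]
      by (simp add: powr_add power_mult_distrib)
    have "(2 * b * A) * (T powr (p + 1) / (p + 1)) = 2 * b * (A * T powr (p + 1)) / (p + 1)" by simp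
    also have "\<dots> = 2 / (p + 1) * (b\<^sup>2 * T)" unfolding 1 by (simp add: power2_eq_square)
    finally have 3: "(2 * b * A) * (T powr (p + 1) / (p + 1)) = 2 / (p + 1) * (b\<^sup>2 * T)" .
    have "A\<^sup>2 * (T powr (2 * p + 1) / (2 * p + 1)) = (A\<^sup>2 * T powr (2 * p + 1)) / (2 * p + 1)" by simp
    also have "\<dots> = 1 / (2 * p + 1) * (b\<^sup>2 * T)" unfolding 2 by simp
    finally have 4: "A\<^sup>2 * (T powr (2 * p + 1) / (2 * p + 1)) = 1 / (2 * p + 1) * (b\<^sup>2 * T)" .
    show ?thesis unfolding 3 4 using T by (simp add: algebra_simps)
  qed
  also have "b\<^sup>2 * T = b powr (2 + 1 / p) * A powr (- 1 / p)"
  proof (cases "b = 0")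
    case False
    thus ?thesis using A b by (simp add: T_def powr_divide powr_add powr_minus field_simps)
  qed (use p in simp)
  finally have hi: "((\<lambda>E. b\<^sup>2 * E powr 0 - (2 * b * A) * E powr p + A\<^sup>2 * E powr (2 * p)) has_integral
     (1 - 2 / (p + 1) + 1 / (2 * p + 1)) * b powr (2 + 1 / p) * A powr (- 1 / p)) {0..T}" by (simp add: mult.assoc)
  have sq: "b\<^sup>2 * E powr 0 - (2 * b * A) * E powr p + A\<^sup>2 * E powr (2 * p) = (b - A * E powr p)\<^sup>2" if "E > 0" for E
  proof -
    have "E powr (2 * p) = (E powr p)\<^sup>2" by (simp add: power2_eq_square flip: powr_add)
    thus ?thesis using that by (simp add: power2_eq_square algebra_simps)
  qed
  have hi2: "((\<lambda>E. (max 0 (b - A * E powr p))\<^sup>2) has_integral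
     (1 - 2 / (p + 1) + 1 / (2 * p + 1)) * b powr (2 + 1 / p) * A powr (- 1 / p)) {0..T}"
  \<comment> \<open>Since \<open>0 powr 0 = 0\<close>, the expanded expression agrees with the
    square only away from E = 0.\<close>
  proof (rule has_integral_spike[OF _ _ hi])
    show "negligible {0::real}" by simp
    fix E assume "E \<in> {0..T} - {0}"
    thus "(max 0 (b - A * E powr p))\<^sup>2 = b\<^sup>2 * E powr 0 - (2 * b * A) * E powr p + A\<^sup>2 * E powr (2 * p)"
      using le[of E] sq[of E] by (simp add: max_def)
  qed
  have "ennreal ((1 - 2 / (p + 1) + 1 / (2 * p + 1)) * b powr (2 + 1 / p) * A powr (- 1 / p)) = 
     (\<integral>\<^sup>+E. ennreal ((max 0 (b - A * E powr p))\<^sup>2) * indicator {0..T} E \<partial>lborel)"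
    by (rule nn_integral_has_integral_lebesgue'[OF _ hi2, symmetric]) simp
  also have "\<dots> = (\<integral>\<^sup>+E. ennreal ((max 0 (b - A * E powr p))\<^sup>2) * indicator {0<..T} E \<partial>lborel)"
  proof (rule nn_integral_cong_AE)
    have "AE E in lborel. E \<noteq> (0::real)" by (rule AE_lborel_singleton)
    thus "AE E in lborel. ennreal ((max 0 (b - A * E powr p))\<^sup>2) * indicator {0..T} E =
       ennreal ((max 0 (b - A * E powr p))\<^sup>2) * indicator {0<..T} E"
      by eventually_elim (auto simp: indicator_def)
  qed
  also have "\<dots> \<le> (\<integral>\<^sup>+E. ennreal ((max 0 (b - A * E powr p))\<^sup>2) * indicator {0<..} E \<partial>lborel)"
    by (intro nn_integral_mono) (auto simp: indicator_def)
  finally show ?thesis .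
qed

section \<open>Low and high frequencies\<close>

lemma eigfun_0 [simp]: "eigfun {} (\<lambda>_. 0) x = 1"
  by (simp add: eigfun_def trig_def)

lemma knorm_eq_0_iff: "knorm k = 0 \<longleftrightarrow> k = (\<lambda>_. 0)"
  by (auto simp: knorm_def sum_nonneg_eq_0_iff)

text \<open>The mode k = 0 contributes the mean. Cauchy-Schwarz bounds the other low modes by a
  Bessel sum times the weighted lattice count, the latter from the pointwise bound on each
  eigenfunction.\<close>

lemma low_frequency_bound:
  fixes u :: "real^'n::finite \<Rightarrow> real"
  assumes u: "u \<in> borel_measurable cube" "integrable cube (\<lambda>x. (u x)\<^sup>2)" and r: "r > 0"
  shows "\<bar>u x - (\<integral>x. u x \<partial>cube)\<bar> \<le> \<bar>u x - (\<Sum>k | knorm k < r. (\<integral>x. u x * eigfun {} k x \<partial>cube) * eigfun {} k x)\<bar>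
     + sqrt ((\<integral>x. (u x)\<^sup>2 \<partial>cube) * (real_of_ereal (Nd TYPE('n)) * r ^ CARD('n)))"
proof -
  define a where "a k = (\<integral>x. u x * eigfun {} k x \<partial>cube)" for k
  define L where "L = {k::'n \<Rightarrow> nat. knorm k < r}"
  define L0 where "L0 = {k::'n \<Rightarrow> nat. 0 < knorm k \<and> knorm k < r}"
  have finL: "finite L" unfolding L_def by (rule finite_knorm_less)
  have LL: "L - {\<lambda>_. 0} = L0"
    unfolding L_def L0_def using knorm_eq_0_iff knorm_nonneg by (auto simp: less_le)
  have finL0: "finite L0" unfolding LL[symmetric] using finL by simp
  have "(\<lambda>_. 0) \<in> L" using r knorm_eq_0_iff[of "\<lambda>_::'n. 0"] by (simp add: L_def)
  hence sumL: "(\<Sum>k\<in>L. a k * eigfun {} k x) = (\<integral>x. u x \<partial>cube) + (\<Sum>k\<in>L0. a k * eigfun {} k x)"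
    using sum.remove[OF finL, of "\<lambda>_. 0" "\<lambda>k. a k * eigfun {} k x"] by (simp add: LL a_def)
  have "(\<Sum>k\<in>L0. a k * eigfun {} k x)\<^sup>2 \<le> (\<Sum>k\<in>L0. (a k)\<^sup>2) * (\<Sum>k\<in>L0. (eigfun {} k x)\<^sup>2)"
    by (rule Cauchy_Schwarz_ineq_sum)
  also have "\<dots> \<le> (\<integral>x. (u x)\<^sup>2 \<partial>cube) * (real_of_ereal (Nd TYPE('n)) * r ^ CARD('n))"
  proof (rule mult_mono)
    show "(\<Sum>k\<in>L0. (a k)\<^sup>2) \<le> (\<integral>x. (u x)\<^sup>2 \<partial>cube)"
      unfolding a_def by (rule Bessel_inequality[OF orthonormal_eigfun[of "{}"]]) (use u finL0 in auto)
    have "(\<Sum>k\<in>L0. (eigfun {} k x)\<^sup>2) \<le> (\<Sum>k\<in>L0. 2 ^ nzcount k)"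
      by (intro sum_mono eigfun_square_le)
    also have "\<dots> \<le> real_of_ereal (Nd TYPE('n)) * r ^ CARD('n)"
      unfolding L0_def by (rule lattice_sum_le_Nd[OF r])
    finally show "(\<Sum>k\<in>L0. (eigfun {} k x)\<^sup>2) \<le> real_of_ereal (Nd TYPE('n)) * r ^ CARD('n)" .
  qed (auto intro: sum_nonneg)
  finally have "\<bar>\<Sum>k\<in>L0. a k * eigfun {} k x\<bar> \<le> sqrt ((\<integral>x. (u x)\<^sup>2 \<partial>cube) * (real_of_ereal (Nd TYPE('n)) * r ^ CARD('n)))"
    by (simp add: real_le_rsqrt)
  thus ?thesis using sumL unfolding L_def[symmetric] a_def[symmetric] by linarith
qed

text \<open>A finite set \<open>F\<close> that nearly exhausts the norm of u may be enlarged by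
  \<open>L\<close>; what it holds outside \<open>L\<close> is a partial sum of the series. The
  enumeration \<open>q\<close> turns the multi-index sum into a series over \<open>nat\<close>,
  which can later be exchanged with the integral over E.\<close>

lemma high_frequency_le_suminf:
  fixes u :: "real^'n::finite \<Rightarrow> real" and q :: "nat \<Rightarrow> 'n \<Rightarrow> nat"
  assumes u: "u \<in> borel_measurable cube" "integrable cube (\<lambda>x. (u x)\<^sup>2)" and q: "bij q"
    and L: "finite L"
  shows "ennreal (\<integral>x. (u x - (\<Sum>k\<in>L. (\<integral>x. u x * eigfun {} k x \<partial>cube) * eigfun {} k x))\<^sup>2 \<partial>cube)
     \<le> (\<Sum>n. ennreal ((\<integral>x. u x * eigfun {} (q n) x \<partial>cube)\<^sup>2) * indicator (- L) (q n))"
proof (rule ennreal_le_epsilon)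
  fix e :: real assume e: "e > 0"
  define a where "a k = (\<integral>x. u x * eigfun {} k x \<partial>cube)" for k
  obtain F where F: "finite F" "(\<integral>x. (u x)\<^sup>2 \<partial>cube) < (\<Sum>k\<in>F. (a k)\<^sup>2) + e"
    using eigfun_complete[OF u e] unfolding a_def by blast
  have "(\<integral>x. (u x - (\<Sum>k\<in>L. a k * eigfun {} k x))\<^sup>2 \<partial>cube) = (\<integral>x. (u x)\<^sup>2 \<partial>cube) - (\<Sum>k\<in>L. (a k)\<^sup>2)"
    unfolding a_def by (subst integral_square_residual(1)[OF orthonormal_eigfun[of "{}"] L _ u]) auto
  moreover have "(\<Sum>k\<in>F. (a k)\<^sup>2) \<le> (\<Sum>k\<in>F \<union> L. (a k)\<^sup>2)" using F L by (intro sum_mono2) auto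
  moreover have "(\<Sum>k\<in>F \<union> L. (a k)\<^sup>2) = (\<Sum>k\<in>F - L. (a k)\<^sup>2) + (\<Sum>k\<in>L. (a k)\<^sup>2)"
    using F L by (subst sum.union_disjoint[symmetric]) auto
  ultimately have "(\<integral>x. (u x - (\<Sum>k\<in>L. a k * eigfun {} k x))\<^sup>2 \<partial>cube) \<le> (\<Sum>k\<in>F - L. (a k)\<^sup>2) + e"
    using F(2) by linarith
  hence "ennreal (\<integral>x. (u x - (\<Sum>k\<in>L. a k * eigfun {} k x))\<^sup>2 \<partial>cube) \<le> ennreal ((\<Sum>k\<in>F - L. (a k)\<^sup>2) + e)"
    by (rule ennreal_leI)
  also have "\<dots> = ennreal (\<Sum>k\<in>F - L. (a k)\<^sup>2) + ennreal e"
    using e by (intro ennreal_plus sum_nonneg) auto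
  also have "ennreal (\<Sum>k\<in>F - L. (a k)\<^sup>2) = (\<Sum>k\<in>F - L. ennreal ((a k)\<^sup>2) * indicator (- L) k)"
    by (subst sum_ennreal[symmetric]) (auto intro!: sum.cong)
  also have "\<dots> = (\<Sum>n\<in>inv q ` (F - L). ennreal ((a (q n))\<^sup>2) * indicator (- L) (q n))"
    using q by (subst sum.reindex) (auto intro!: inj_on_subset[OF bij_is_inj[OF bij_imp_bij_inv]] sum.cong simp: surj_f_inv_f[OF bij_is_surj])
  also have "\<dots> \<le> (\<Sum>n. ennreal ((a (q n))\<^sup>2) * indicator (- L) (q n))"
    by (rule sum_le_suminf) (use F in auto)
  finally show "ennreal (\<integral>x. (u x - (\<Sum>k\<in>L. (\<integral>x. u x * eigfun {} k x \<partial>cube) * eigfun {} k x))\<^sup>2 \<partial>cube)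
     \<le> (\<Sum>n. ennreal ((\<integral>x. u x * eigfun {} (q n) x \<partial>cube)\<^sup>2) * indicator (- L) (q n)) + ennreal e"
    unfolding a_def by (simp add: add_right_mono)
qed

lemma ex_bij_nat_multiindex: "\<exists>q :: nat \<Rightarrow> 'n::finite \<Rightarrow> nat. bij q"
proof -
  have "infinite (UNIV :: ('n \<Rightarrow> nat) set)"
  proof
    assume "finite (UNIV :: ('n \<Rightarrow> nat) set)"
    hence "finite (range (\<lambda>m::nat. \<lambda>_::'n. m))" by (rule finite_subset[rotated]) auto
    moreover have "inj (\<lambda>m::nat. \<lambda>_::'n. m)" by (auto simp: inj_def fun_eq_iff)
    ultimately show False using finite_imageD by blast
  qed
  thus ?thesis using bij_betw_from_nat_into[of "UNIV :: ('n \<Rightarrow> nat) set"] by blast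
qed

text \<open>The coefficient of k belongs to the remainder exactly for E in the interval from 0 to
  \<open>(pi * knorm k)\<^sup>2\<close>, so the integral over E weights its square by the length of
  that interval.\<close>

lemma layer_cake_le_gradient:
  fixes u :: "real^'n::finite \<Rightarrow> real"
  assumes W: "W11_grad (box 0 1) u g" and g2: "integrable cube (\<lambda>x. (norm (g x))\<^sup>2)"
    and u: "u \<in> borel_measurable cube" "integrable cube (\<lambda>x. (u x)\<^sup>2)"
  shows "(\<integral>\<^sup>+E. ennreal (\<integral>x. (u x - (\<Sum>k | knorm k < sqrt E / pi. (\<integral>x. u x * eigfun {} k x \<partial>cube) * eigfun {} k x))\<^sup>2 \<partial>cube)
            * indicator {0<..} E \<partial>lborel) \<le> ennreal (\<integral>x. (norm (g x))\<^sup>2 \<partial>cube)"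
proof -
  define a where "a k = (\<integral>x. u x * eigfun {} k x \<partial>cube)" for k
  obtain q :: "nat \<Rightarrow> 'n \<Rightarrow> nat" where q: "bij q" using ex_bij_nat_multiindex by blast
  have "(\<integral>\<^sup>+E. ennreal (\<integral>x. (u x - (\<Sum>k | knorm k < sqrt E / pi. a k * eigfun {} k x))\<^sup>2 \<partial>cube)
            * indicator {0<..} E \<partial>lborel)
     \<le> (\<integral>\<^sup>+E. (\<Sum>n. ennreal ((a (q n))\<^sup>2) * indicator {0<..(pi * knorm (q n))\<^sup>2} E) \<partial>lborel)"
  proof (rule nn_integral_mono)
    fix E :: real
    show "ennreal (\<integral>x. (u x - (\<Sum>k | knorm k < sqrt E / pi. a k * eigfun {} k x))\<^sup>2 \<partial>cube) * indicator {0<..} E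
      \<le> (\<Sum>n. ennreal ((a (q n))\<^sup>2) * indicator {0<..(pi * knorm (q n))\<^sup>2} E)"
    proof (cases "E > 0")
      case True
      have "ennreal (\<integral>x. (u x - (\<Sum>k | knorm k < sqrt E / pi. a k * eigfun {} k x))\<^sup>2 \<partial>cube) 
        \<le> (\<Sum>n. ennreal ((a (q n))\<^sup>2) * indicator (- {k. knorm k < sqrt E / pi}) (q n))"
        unfolding a_def by (rule high_frequency_le_suminf[OF u q finite_knorm_less])
      also have "(\<lambda>n. indicator (- {k. knorm k < sqrt E / pi}) (q n)) = (\<lambda>n. indicator {0<..(pi * knorm (q n))\<^sup>2} E :: ennreal)"
      proof
        fix n
        have "\<not> knorm (q n) < sqrt E / pi \<longleftrightarrow> sqrt E \<le> pi * knorm (q n)" by (simp add: not_less field_simps)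
        also have "\<dots> \<longleftrightarrow> E \<le> (pi * knorm (q n))\<^sup>2"
          using True by (simp add: real_sqrt_le_iff' )
        finally show "indicator (- {k. knorm k < sqrt E / pi}) (q n) = (indicator {0<..(pi * knorm (q n))\<^sup>2} E :: ennreal)"
          using True by (simp add: indicator_def)
      qed
      finally show ?thesis using True by simp
    qed simp
  qed
  also have "\<dots> = (\<Sum>n. \<integral>\<^sup>+E. ennreal ((a (q n))\<^sup>2) * indicator {0<..(pi * knorm (q n))\<^sup>2} E \<partial>lborel)"
    by (rule nn_integral_suminf) auto
  also have "\<dots> = (\<Sum>n. ennreal ((pi * knorm (q n))\<^sup>2 * (a (q n))\<^sup>2))"
    by (subst nn_integral_cmult_indicator) (auto simp: ennreal_mult mult.commute)
  also have "\<dots> \<le> ennreal (\<integral>x. (norm (g x))\<^sup>2 \<partial>cube)"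
  proof (rule suminf_le_const)
    fix n
    have "(\<Sum>i<n. ennreal ((pi * knorm (q i))\<^sup>2 * (a (q i))\<^sup>2)) = ennreal (\<Sum>k\<in>q ` {..<n}. (pi * knorm k)\<^sup>2 * (a k)\<^sup>2)"
      using q by (subst sum.reindex) (auto intro: inj_on_subset[OF bij_is_inj] simp: sum_ennreal)
    also have "\<dots> \<le> ennreal (\<integral>x. (norm (g x))\<^sup>2 \<partial>cube)"
      unfolding a_def by (intro ennreal_leI gradient_Bessel[OF W g2]) auto
    finally show "(\<Sum>i<n. ennreal ((pi * knorm (q i))\<^sup>2 * (a (q i))\<^sup>2)) \<le> ennreal (\<integral>x. (norm (g x))\<^sup>2 \<partial>cube)" .
  qed auto
  finally show ?thesis unfolding a_def .
qed

lemma Gagliardo_Nirenberg_cube: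
  fixes u :: "real^'n::finite \<Rightarrow> real"
  assumes W: "W11_grad (box 0 1) u g" and g2: "integrable cube (\<lambda>x. (norm (g x))\<^sup>2)"
    and u: "u \<in> borel_measurable cube" "integrable cube (\<lambda>x. (u x)\<^sup>2)" and n2: "(\<integral>x. (u x)\<^sup>2 \<partial>cube) > 0"
    and d: "d = real CARD('n)"
  shows "ennreal (pi\<^sup>2 * d\<^sup>2 / ((d + 4) * (d + 2) * real_of_ereal (Nd TYPE('n)) powr (2 / d)))
       * (\<integral>\<^sup>+x. ennreal (\<bar>u x - (\<integral>x. u x \<partial>cube)\<bar> powr (2 + 4 / d)) \<partial>cube)
     \<le> ennreal ((\<integral>x. (norm (g x))\<^sup>2 \<partial>cube) * (\<integral>x. (u x)\<^sup>2 \<partial>cube) powr (2 / d))"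
proof -
  define m where "m = (\<integral>x. u x \<partial>cube)"
  define N where "N = real_of_ereal (Nd TYPE('n))"
  define n2 where "n2 = (\<integral>x. (u x)\<^sup>2 \<partial>cube)"
  define I where "I = (\<integral>x. (norm (g x))\<^sup>2 \<partial>cube)"
  \<comment> \<open>Chosen so that the low-frequency bound at radius \<open>sqrt E / pi\<close>
    reads \<open>A * E powr (d / 4)\<close>.\<close>
  define A where "A = sqrt (n2 * N / pi ^ CARD('n))"
  have N: "N > 0" unfolding N_def by (rule Nd_pos)
  have n2_pos: "n2 > 0" using n2 by (simp add: n2_def)
  have A: "A > 0" using N n2_pos by (simp add: A_def)
  have d0: "d > 0" by (simp add: d)
  note [measurable] = u(1)
  define w where "w E x = u x - (\<Sum>k | knorm k < sqrt E / pi. (\<integral>x. u x * eigfun {} k x \<partial>cube) * eigfun {} k x)" for E x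
  have A_eq: "sqrt (n2 * (N * (sqrt E / pi) ^ CARD('n))) = A * E powr (d / 4)" if "E > 0" for E
  proof -
    have "sqrt E ^ CARD('n) = E powr (d / 2)"
      using that by (simp add: d powr_half_sqrt[symmetric] powr_realpow[symmetric] powr_powr)
    moreover have "sqrt (E powr (d / 2)) = E powr (d / 4)"
      using that by (simp add: powr_half_sqrt[symmetric] powr_powr)
    ultimately have "E powr (d / 4) = sqrt (sqrt E ^ CARD('n))" by simp
    thus ?thesis by (simp add: A_def power_divide flip: real_sqrt_mult)
  qed
  have pw: "(max 0 (\<bar>u x - m\<bar> - A * E powr (d / 4)))\<^sup>2 \<le> (w E x)\<^sup>2" if "E > 0" for E x
  proof -
    have "\<bar>u x - m\<bar> \<le> \<bar>w E x\<bar> + A * E powr (d / 4)"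
      using low_frequency_bound[OF u, of "sqrt E / pi" x] that
      unfolding m_def w_def A_eq[OF that, symmetric] n2_def N_def by simp
    hence "\<bar>max 0 (\<bar>u x - m\<bar> - A * E powr (d / 4))\<bar> \<le> \<bar>w E x\<bar>" by linarith
    thus ?thesis by (simp only: abs_le_square_iff)
  qed
  define c where "c = (1 - 2 / (d / 4 + 1) + 1 / (2 * (d / 4) + 1)) * A powr (- 1 / (d / 4))"
  have w2: "ennreal (\<integral>x. (w E x)\<^sup>2 \<partial>cube) = (\<integral>\<^sup>+x. ennreal ((w E x)\<^sup>2) \<partial>cube)" for E
    unfolding w_def 
    by (rule nn_integral_eq_integral[symmetric], rule integral_square_residual(2)[OF orthonormal_eigfun[of "{}"] finite_knorm_less _ u]) auto
  interpret cube: finite_measure "cube :: (real^'n) measure" by (rule finite_measure_cube)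
  interpret pair_sigma_finite "cube :: (real^'n) measure" "lborel :: real measure" ..
  \<comment> \<open>Tonelli is applied to this explicit function of x and E; the spectral remainder
    \<open>w E\<close> enters only after the exchange, for fixed E.\<close>
  define f where "f x E = ennreal ((max 0 (\<bar>u x - m\<bar> - A * E powr (d / 4)))\<^sup>2) * indicator {0<..} E" for x and E :: real
  have f_meas: "case_prod f \<in> borel_measurable (cube \<Otimes>\<^sub>M lborel)" unfolding f_def by measurable
  have "ennreal c * (\<integral>\<^sup>+x. ennreal (\<bar>u x - m\<bar> powr (2 + 4 / d)) \<partial>cube) = (\<integral>\<^sup>+x. ennreal c * ennreal (\<bar>u x - m\<bar> powr (2 + 4 / d)) \<partial>cube)"
    by (rule nn_integral_cmult[symmetric]) measurable
  also have "\<dots> \<le> (\<integral>\<^sup>+x. (\<integral>\<^sup>+E. f x E \<partial>lborel) \<partial>cube)"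
  proof (rule nn_integral_mono)
    fix x
    have "ennreal c * ennreal (\<bar>u x - m\<bar> powr (2 + 4 / d)) = 
      ennreal ((1 - 2 / (d / 4 + 1) + 1 / (2 * (d / 4) + 1)) * \<bar>u x - m\<bar> powr (2 + 1 / (d / 4)) * A powr (- 1 / (d / 4)))"
      by (subst ennreal_mult''[symmetric]) (auto simp: c_def mult_ac)
    also have "\<dots> \<le> (\<integral>\<^sup>+E. f x E \<partial>lborel)"
      unfolding f_def by (rule nn_integral_truncated_power) (use A d0 in auto)
    finally show "ennreal c * ennreal (\<bar>u x - m\<bar> powr (2 + 4 / d)) \<le> (\<integral>\<^sup>+E. f x E \<partial>lborel)" .
  qed
  also have "\<dots> = (\<integral>\<^sup>+E. (\<integral>\<^sup>+x. f x E \<partial>cube) \<partial>lborel)"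
    by (rule Fubini'[OF f_meas, symmetric])
  also have "\<dots> \<le> (\<integral>\<^sup>+E. ennreal (\<integral>x. (w E x)\<^sup>2 \<partial>cube) * indicator {0<..} E \<partial>lborel)"
  proof (rule nn_integral_mono)
    fix E :: real
    show "(\<integral>\<^sup>+x. f x E \<partial>cube) \<le> ennreal (\<integral>x. (w E x)\<^sup>2 \<partial>cube) * indicator {0<..} E"
    proof (cases "E > 0")
      case True
      thus ?thesis unfolding w2 f_def by (auto intro!: nn_integral_mono ennreal_leI pw)
    qed (simp add: f_def)
  qed
  also have "\<dots> \<le> ennreal I" unfolding w_def I_def by (rule layer_cake_le_gradient[OF W g2 u])
  finally have main: "ennreal c * (\<integral>\<^sup>+x. ennreal (\<bar>u x - m\<bar> powr (2 + 4 / d)) \<partial>cube) \<le> ennreal I" .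
  \<comment> \<open>At p = d/4 the bracket 1 - 8/(d + 4) + 2/(d + 2) collapses to d^2/((d + 4)(d +
    2)), and the power -4/d of \<open>A\<close> releases pi^2 and the powers 2/d of the norm and of
    \<open>N\<close>.\<close>
  have cc: "n2 powr (2 / d) * c = pi\<^sup>2 * d\<^sup>2 / ((d + 4) * (d + 2) * N powr (2 / d))"
  proof -
    have "(1 - 2 / (d / 4 + 1) + 1 / (2 * (d / 4) + 1)) = d\<^sup>2 / ((d + 4) * (d + 2))"
      using d0 by (simp add: divide_simps) (simp add: power2_eq_square algebra_simps)
    moreover have "A powr (- 1 / (d / 4)) = pi\<^sup>2 / (n2 powr (2 / d) * N powr (2 / d))"
    proof -
      have "A powr (- 1 / (d / 4)) = (n2 * N / pi ^ CARD('n)) powr (- (2 / d))"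
        unfolding A_def using N n2_pos by (simp add: powr_half_sqrt[symmetric] powr_powr)
      also have "\<dots> = (pi powr d) powr (2 / d) / (n2 powr (2 / d) * N powr (2 / d))"
        using N n2_pos by (simp add: powr_minus powr_divide powr_mult d powr_realpow)
      also have "(pi powr d) powr (2 / d) = pi\<^sup>2" using d0 by (simp add: powr_powr)
      finally show ?thesis .
    qed
    ultimately show ?thesis using n2_pos by (simp add: c_def mult_ac)
  qed
  have "ennreal (n2 powr (2 / d)) * (ennreal c * (\<integral>\<^sup>+x. ennreal (\<bar>u x - m\<bar> powr (2 + 4 / d)) \<partial>cube))
     \<le> ennreal (n2 powr (2 / d)) * ennreal I" using main by (rule mult_left_mono) simp
  also have "\<dots> = ennreal (I * n2 powr (2 / d))" by (simp add: ennreal_mult'' I_def mult.commute)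
  also have "ennreal (n2 powr (2 / d)) * (ennreal c * (\<integral>\<^sup>+x. ennreal (\<bar>u x - m\<bar> powr (2 + 4 / d)) \<partial>cube)) =
     ennreal (pi\<^sup>2 * d\<^sup>2 / ((d + 4) * (d + 2) * N powr (2 / d))) * (\<integral>\<^sup>+x. ennreal (\<bar>u x - m\<bar> powr (2 + 4 / d)) \<partial>cube)"
    unfolding cc[symmetric] by (simp add: ennreal_mult' mult.assoc)
  finally show ?thesis unfolding m_def N_def n2_def I_def .
qed

section \<open>From the inequality to the infimum\<close>

lemma AE_cube_iff: "(AE x in cube. P x) \<longleftrightarrow> (AE x in lborel. x \<in> box 0 1 \<longrightarrow> P x)"
  unfolding cube_def by (rule AE_restrict_space_iff) simp

text \<open>Dividing in \<open>ennreal\<close> requires a denominator that is neither 0 nor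
  infinite. It is not 0 because u is not almost everywhere constant, which also makes the norm of u
  positive.\<close>

lemma GQ_ge:
  assumes d: "d = real CARD('n::finite)"
  shows "ennreal (pi\<^sup>2 * d\<^sup>2 / ((d + 4) * (d + 2) * real_of_ereal (Nd TYPE('n)) powr (2 / d))) \<le> GQ TYPE('n)"
  unfolding GQ_def G_def
proof (rule Inf_greatest, clarify)
  fix u :: "real^'n \<Rightarrow> real" and g :: "real^'n \<Rightarrow> real^'n"
  assume W: "W11_grad (box 0 1) u g" and nc: "\<nexists>c. AE x in lborel. x \<in> box 0 1 \<longrightarrow> u x = c"
    and gfin: "(\<integral>\<^sup>+x\<in>box 0 1. ennreal ((norm (g x))\<^sup>2) \<partial>lborel) < \<infinity>"
    and ufin: "(\<integral>\<^sup>+x\<in>box 0 1. ennreal ((u x)\<^sup>2) \<partial>lborel) < \<infinity>"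
  have nc': "\<not> (AE x in cube. u x = c)" for c using nc by (simp add: AE_cube_iff)
  have u [measurable]: "u \<in> borel_measurable cube"
    using W by (auto simp: W11_grad_def integrable_cube_iff[symmetric] dest: borel_measurable_integrable)
  have [measurable]: "(\<lambda>x. g x $ i) \<in> borel_measurable cube" for i
    using W by (auto simp: W11_grad_def integrable_cube_iff[symmetric] dest: borel_measurable_integrable)
  have g [measurable]: "(\<lambda>x. (norm (g x))\<^sup>2) \<in> borel_measurable cube"
    by (simp add: norm_vec_def L2_set_def sum_nonneg)
  have g2: "integrable cube (\<lambda>x. (norm (g x))\<^sup>2)"
    using gfin by (intro integrableI_nonneg) (auto simp: nn_integral_cube)
  have u2: "integrable cube (\<lambda>x. (u x)\<^sup>2)"
    using ufin by (intro integrableI_nonneg) (auto simp: nn_integral_cube)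
  have Ig: "enn2real (\<integral>\<^sup>+x\<in>box 0 1. ennreal ((norm (g x))\<^sup>2) \<partial>lborel) = (\<integral>x. (norm (g x))\<^sup>2 \<partial>cube)"
    by (subst integral_eq_nn_integral) (auto simp: nn_integral_cube)
  have Iu: "enn2real (\<integral>\<^sup>+x\<in>box 0 1. ennreal ((u x)\<^sup>2) \<partial>lborel) = (\<integral>x. (u x)\<^sup>2 \<partial>cube)"
    by (subst integral_eq_nn_integral) (auto simp: nn_integral_cube)
  have mean: "mean_on (box 0 1) u = (\<integral>x. u x \<partial>cube)"
    by (simp add: mean_on_def integral_cube measure_def emeasure_unit_box)
  have n2: "(\<integral>x. (u x)\<^sup>2 \<partial>cube) > 0"
  proof (rule ccontr)
    assume "\<not> (\<integral>x. (u x)\<^sup>2 \<partial>cube) > 0"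
    moreover have "0 \<le> (\<integral>x. (u x)\<^sup>2 \<partial>cube)" by simp
    ultimately have "(\<integral>x. (u x)\<^sup>2 \<partial>cube) = 0" by linarith
    hence "AE x in cube. (u x)\<^sup>2 = 0" using integral_nonneg_eq_0_iff_AE[OF u2] by simp
    with nc'[of 0] show False by simp
  qed
  define D where "D = (\<integral>\<^sup>+x. ennreal (\<bar>u x - (\<integral>x. u x \<partial>cube)\<bar> powr (2 + 4 / d)) \<partial>cube)"
  define I where "I = (\<integral>x. (norm (g x))\<^sup>2 \<partial>cube) * (\<integral>x. (u x)\<^sup>2 \<partial>cube) powr (2 / d)"
  define K where "K = pi\<^sup>2 * d\<^sup>2 / ((d + 4) * (d + 2) * real_of_ereal (Nd TYPE('n)) powr (2 / d))"
  have K: "K > 0" using Nd_pos[where 'n='n] by (simp add: K_def d)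
  have I: "I \<ge> 0" by (simp add: I_def)
  have le: "ennreal K * D \<le> ennreal I"
    unfolding K_def D_def I_def by (rule Gagliardo_Nirenberg_cube[OF W g2 u u2 n2 d])
  have D0: "D \<noteq> 0"
  proof
    assume "D = 0"
    hence "AE x in cube. ennreal (\<bar>u x - (\<integral>x. u x \<partial>cube)\<bar> powr (2 + 4 / d)) = 0"
      unfolding D_def by (subst (asm) nn_integral_0_iff_AE) auto
    hence "AE x in cube. u x = (\<integral>x. u x \<partial>cube)" by eventually_elim simp
    with nc' show False by blast
  qed
  \<comment> \<open>Finiteness of the denominator comes from the inequality itself, as
    \<open>K\<close> is positive and the right side is finite.\<close>
  have "D \<noteq> top"
  proof
    assume "D = top"
    hence "ennreal K * D = top" using K by (simp add: ennreal_mult_top)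
    with le show False by (simp add: top_unique)
  qed
  then obtain r where r: "D = ennreal r" "r \<ge> 0" by (cases D) auto
  with D0 have r0: "r > 0" by (cases "r = 0") auto
  have "K * r \<le> I" using le K I r by (simp flip: ennreal_mult)
  hence "K \<le> I / r" using r0 by (simp add: field_simps)
  hence "ennreal K \<le> ennreal (I / r)" by (rule ennreal_leI)
  also have "\<dots> = ennreal I / D" using r r0 I by (simp add: divide_ennreal)
  finally show "ennreal (pi\<^sup>2 * d\<^sup>2 / ((d + 4) * (d + 2) * real_of_ereal (Nd TYPE('n)) powr (2 / d))) \<le>
     ennreal (enn2real (\<integral>\<^sup>+x\<in>box 0 1. ennreal ((norm (g x))\<^sup>2) \<partial>lborel)
        * enn2real (\<integral>\<^sup>+x\<in>box 0 1. ennreal ((u x)\<^sup>2) \<partial>lborel) powr (2 / real CARD('n)))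
     / (\<integral>\<^sup>+x\<in>box 0 1. ennreal (\<bar>u x - mean_on (box 0 1) u\<bar> powr (2 + 4 / real CARD('n))) \<partial>lborel)"
    unfolding Ig Iu mean K_def I_def D_def d nn_integral_cube .
qed

theorem theorem3p1:
  fixes d :: nat
  assumes "d = CARD('n::finite)"
  shows "Nd TYPE('n) \<le> ereal (\<Sum>l=1..d. real (d choose l) * unit_ball_vol (real l)
                                    / real l powr ((real d - real l) / 2))
         \<and> ennreal (pi\<^sup>2 * (real d)\<^sup>2 /
          ((real d + 4) * (real d + 2) * real_of_ereal (Nd TYPE('n)) powr (2 / real d)))
         \<le> GQ TYPE('n)"
  using Nd_le[where 'n='n] GQ_ge[where 'n='n and d="real d"] assms by simp

end
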